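(* The problem $\textsf{Wordle}$ can be solved in polynomial time if the alphabet size $\sigma=|\Sigma|$ is a constant.
   Context: Wordle game: a dictionary $D\subseteq\Sigma^k$ (a finite set of words, all of the same length $k$, over a finite alphabet $\Sigma$) is given explicitly as a list of words and is known to the guesser. A secret word $w\in D$ is chosen. The guesser makes guesses $p_1,p_2,\dots$, each of which must be a word of $D$; she wins if some guess among the first $\ell$ is exactly $w$. After each guess $p$ she receives the following marking of the positions of $p$: iterating over indices $i=1,\dots,k$, if $w[i]=p[i]$ then $p[i]$ is marked green; if $w[i]\neq p[i]$ and the set $S_i=\{j : p[j]=w[i],\ p[j]\text{ is not yet marked}\}$ is nonempty, then $p[\min S_i]$ is marked yellow. All positions of $p$ not marked after this iteration are marked gray. A strategy chooses each next guess (in $D$) as a function of the markings received so far; it is winning within $\ell$ guesses if for every secret word $w\in D$ it guesses $w$ within its first $\ell$ guesses. The problem $\textsf{Wordle}$: input $(D,\ell)$ with $D\subseteq\Sigma^k$ and integer $\ell\ge1$; answer Yes iff the guesser has a winning strategy within $\ell$ guesses. *)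

theory Defs
  imports "HOL-Computational_Algebra.Polynomial"
begin

section \<open>Deterministic multitape Turing machines\<close>

text \<open>
  States are numbers below \<open>states M\<close>, tape symbols are numbers below \<open>symbols M\<close>, and symbol
  0 is the blank. The tapes are infinite in both directions; the input is written on the cells
  \<open>0, ..., n - 1\<close> of the first tape, and all other cells of all tapes are blank initially.
\<close>

datatype move = Move_Left | Stay | Move_Right

record turing_machine =
  tapes :: nat
  states :: nat
  symbols :: nat
  start :: nat
  accept :: nat
  reject :: nat
  transition :: "nat \<Rightarrow> nat list \<Rightarrow> nat \<times> (nat \<times> move) list"

definition wf_tm :: "turing_machine \<Rightarrow> bool" where
  "wf_tm M \<longleftrightarrow>
     1 \<le> tapes M \<and> 0 < symbols M \<and>
     start M < states M \<and> accept M < states M \<and> reject M < states M \<and> accept M \<noteq> reject M \<and>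
     (\<forall>q < states M. \<forall>as. length as = tapes M \<and> set as \<subseteq> {..<symbols M} \<longrightarrow>
        (case transition M q as of (q', acts) \<Rightarrow>
           q' < states M \<and> length acts = tapes M \<and> (\<forall>(b, d) \<in> set acts. b < symbols M)))"

text \<open>A tape is given by its contents and the position of the head.\<close>

type_synonym tape = "(int \<Rightarrow> nat) \<times> int"
type_synonym config = "nat \<times> tape list"

definition tape_read :: "tape \<Rightarrow> nat" where
  "tape_read = (\<lambda>(c, h). c h)"

definition tape_act :: "tape \<Rightarrow> nat \<times> move \<Rightarrow> tape" where
  "tape_act = (\<lambda>(c, h) (b, d).
     (c(h := b), case d of Move_Left \<Rightarrow> h - 1 | Stay \<Rightarrow> h | Move_Right \<Rightarrow> h + 1))"

definition tm_step :: "turing_machine \<Rightarrow> config \<Rightarrow> config" where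
  "tm_step M = (\<lambda>(q, ts).
     if q = accept M \<or> q = reject M then (q, ts)
     else (case transition M q (map tape_read ts) of (q', acts) \<Rightarrow> (q', map2 tape_act ts acts)))"

definition input_tape :: "nat list \<Rightarrow> tape" where
  "input_tape x = ((\<lambda>i. if 0 \<le> i \<and> i < int (length x) then x ! nat i else 0), 0)"

definition init_config :: "turing_machine \<Rightarrow> nat list \<Rightarrow> config" where
  "init_config M x = (start M, input_tape x # replicate (tapes M - 1) (\<lambda>_. 0, 0))"

text \<open>
  Since \<open>tm_step\<close> leaves halted configurations unchanged, being in a halting state after exactly
  \<open>t\<close> steps means halting in that state within \<open>t\<close> steps.
\<close>

definition decides_in_time ::
  "turing_machine \<Rightarrow> nat set \<Rightarrow> nat list set \<Rightarrow> (nat \<Rightarrow> nat) \<Rightarrow> bool" where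
  "decides_in_time M A L T \<longleftrightarrow>
     (\<forall>x. set x \<subseteq> A \<longrightarrow>
        fst ((tm_step M ^^ T (length x)) (init_config M x)) = (if x \<in> L then accept M else reject M))"

text \<open>\<open>A\<close> is the (finite, blank-free) input alphabet of the language \<open>L\<close>.\<close>

definition poly_time_decidable :: "nat set \<Rightarrow> nat list set \<Rightarrow> bool" where
  "poly_time_decidable A L \<longleftrightarrow>
     finite A \<and> 0 \<notin> A \<and> L \<subseteq> lists A \<and>
     (\<exists>M (p :: nat poly). wf_tm M \<and> A \<subseteq> {..<symbols M} \<and> decides_in_time M A L (poly p))"


section \<open>The Wordle game\<close>

datatype mark = Green | Yellow | Gray

text \<open>
  \<open>mark_step p w i m\<close> performs the iteration for index \<open>i\<close> on the partial marking \<open>m\<close> of the guess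
  \<open>p\<close> for the secret word \<open>w\<close>. A position that was marked yellow earlier can thereby turn green.
\<close>

definition mark_step ::
  "'a list \<Rightarrow> 'a list \<Rightarrow> nat \<Rightarrow> (nat \<Rightarrow> mark option) \<Rightarrow> nat \<Rightarrow> mark option" where
  "mark_step p w i m =
     (if w ! i = p ! i then m(i := Some Green)
      else let S = {j. j < length p \<and> p ! j = w ! i \<and> m j = None} in
        if S \<noteq> {} then m(Min S := Some Yellow) else m)"

definition marking :: "'a list \<Rightarrow> 'a list \<Rightarrow> mark list" where
  "marking p w =
     (let m = fold (mark_step p w) [0..<length p] (\<lambda>_. None)
      in map (\<lambda>j. case m j of None \<Rightarrow> Gray | Some c \<Rightarrow> c) [0..<length p])"

text \<open>
  A strategy maps the list of markings received so far (oldest first) to the next guess.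
  \<open>feedback s w n\<close> lists the markings received for the first \<open>n\<close> guesses.
\<close>

type_synonym 'a strategy = "mark list list \<Rightarrow> 'a list"

fun feedback :: "'a strategy \<Rightarrow> 'a list \<Rightarrow> nat \<Rightarrow> mark list list" where
  "feedback s w 0 = []"
| "feedback s w (Suc n) = feedback s w n @ [marking (s (feedback s w n)) w]"

definition winning_strategy :: "'a list set \<Rightarrow> nat \<Rightarrow> 'a strategy \<Rightarrow> bool" where
  "winning_strategy D l s \<longleftrightarrow>
     (\<forall>h. s h \<in> D) \<and> (\<forall>w \<in> D. \<exists>n < l. s (feedback s w n) = w)"

definition guesser_wins :: "'a list set \<Rightarrow> nat \<Rightarrow> bool" where
  "guesser_wins D l \<longleftrightarrow> (\<exists>s. winning_strategy D l s)"


section \<open>The decision problem for a fixed alphabet size\<close>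

text \<open>The alphabet of size \<open>\<sigma>\<close> is \<open>{0, ..., \<sigma> - 1}\<close>.\<close>

definition words_of_length :: "nat \<Rightarrow> nat \<Rightarrow> nat list set" where
  "words_of_length \<sigma> k = {w. length w = k \<and> set w \<subseteq> {..<\<sigma>}}"

text \<open>Binary representation, most significant digit first, without leading zeros.\<close>

fun binary :: "nat \<Rightarrow> nat list" where
  "binary n = (if n = 0 then [] else binary (n div 2) @ [n mod 2])"

declare binary.simps [simp del]

text \<open>
  Input symbols: 1 precedes every word, 2 and 3 are the binary digits 0 and 1, and \<open>4 + a\<close> is
  the letter \<open>a\<close>.
\<close>

definition wordle_alphabet :: "nat \<Rightarrow> nat set" where
  "wordle_alphabet \<sigma> = {1..<4 + \<sigma>}"

definition encode_instance :: "nat list list \<Rightarrow> nat \<Rightarrow> nat list" where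
  "encode_instance ws l =
     map (\<lambda>b. 2 + b) (binary l) @ concat (map (\<lambda>w. 1 # map (\<lambda>a. 4 + a) w) ws)"

text \<open>
  The list \<open>ws\<close> presents the dictionary \<open>set ws\<close>; any order, and repetitions, are permitted.
  The language contains no encoding with an empty dictionary, as no strategy exists for it.
\<close>

definition wordle :: "nat \<Rightarrow> nat list set" where
  "wordle \<sigma> =
     {encode_instance ws l | ws l k.
        set ws \<subseteq> words_of_length \<sigma> k \<and> 1 \<le> l \<and> guesser_wins (set ws) l}"

end

theory Submission imports Defs begin

text \<open>
  Guessing words that agree with all markings received so far wins within \<open>\<sigma>\<close> guesses: at each
  position such a guess either repeats a letter known to be correct or tries a new one. So only the
  numbers of guesses \<open>l < \<sigma>\<close> matter, and for each of them the game is a formula with \<open>2 l\<close>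
  quantifiers over the dictionary (a guess, then a word standing for the marking received), whose
  matrix compares markings. Such a formula is evaluated by nested loops over positions of the
  input with boundedly many counters of size at most \<open>n + 1\<close>, that is, by a Turing machine that
  moves boundedly many heads over copies of its input.
\<close>

section \<open>Programs moving heads over copies of the input\<close>

text \<open>The number of markings that can follow a guess grows with the input, so even for a fixed
  number of guesses there are too many strategies to search through. No strategy is ever
  represented: the alternation of quantifiers has bounded depth, and the set of remaining words is
  recomputed from the guesses made and the markings received. Two more objects do not fit into
  boundedly many counters. The partial marking has one entry per position; the single pointer
  \<open>fill\<close> replaces it. The number l, written in binary, may be exponential in the input
  length; it is only compared with the numerals of the constants below \<sigma>, and every other l
  is accepted as soon as the input is well formed. Commands and terms stand between the machine and
  the formula so that the finiteness of the control and the polynomial time bound each follow by an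
  induction over syntax.\<close>

text \<open>
  A register is the position of a head on its own copy of the input. \<open>Inc\<close> stops at the first blank
  after the input and \<open>Dec\<close> at the left end, so registers range over \<open>0, ..., n + 1\<close>.
\<close>

datatype cmd = Inc nat | Dec nat | Seq cmd cmd | Cond nat nat cmd cmd | While nat nat cmd

text \<open>
  The symbol read by a head at position \<open>v\<close>: the left end is marked by 1, the input symbol \<open>a\<close> is
  stored as \<open>a + 1\<close> in order not to collide with the marker, and 0 is the blank after the input.
\<close>

definition symb :: "nat list \<Rightarrow> nat \<Rightarrow> nat" where
  "symb x v = (if v = 0 then 1 else if v \<le> length x then Suc (x ! (v - 1)) else 0)"

text \<open>The control state is the stack of the commands that remain to be executed.\<close>

fun act :: "cmd list \<Rightarrow> (nat \<Rightarrow> nat) \<Rightarrow> cmd list \<times> (nat \<Rightarrow> move)" where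
  "act [] f = ([], \<lambda>_. Stay)"
| "act (Inc v # ks) f = (ks, (\<lambda>_. Stay)(v := if f v = 0 then Stay else Move_Right))"
| "act (Dec v # ks) f = (ks, (\<lambda>_. Stay)(v := if f v = 1 then Stay else Move_Left))"
| "act (Seq a b # ks) f = (a # b # ks, \<lambda>_. Stay)"
| "act (Cond v z a b # ks) f = ((if f v = z then a else b) # ks, \<lambda>_. Stay)"
| "act (While v z a # ks) f = (if f v = z then ks else a # While v z a # ks, \<lambda>_. Stay)"

definition move_reg :: "move \<Rightarrow> nat \<Rightarrow> nat" where
  "move_reg d v = (case d of Move_Left \<Rightarrow> v - 1 | Stay \<Rightarrow> v | Move_Right \<Rightarrow> Suc v)"

definition cstep :: "nat list \<Rightarrow> cmd list \<times> (nat \<Rightarrow> nat) \<Rightarrow> cmd list \<times> (nat \<Rightarrow> nat)" where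
  "cstep x = (\<lambda>(ks, r). case act ks (\<lambda>i. symb x (r i)) of
     (ks', mv) \<Rightarrow> (ks', \<lambda>i. move_reg (mv i) (r i)))"

primrec regs :: "cmd \<Rightarrow> nat set" where
  "regs (Inc v) = {v}"
| "regs (Dec v) = {v}"
| "regs (Seq a b) = regs a \<union> regs b"
| "regs (Cond v z a b) = insert v (regs a \<union> regs b)"
| "regs (While v z a) = insert v (regs a)"

text \<open>The stacks reachable from \<open>c # ks\<close> while \<open>c\<close> is being executed; their finiteness bounds the set of states.\<close>

primrec conts :: "cmd \<Rightarrow> cmd list \<Rightarrow> cmd list set" where
  "conts (Inc v) ks = {Inc v # ks}"
| "conts (Dec v) ks = {Dec v # ks}"
| "conts (Seq a b) ks = insert (Seq a b # ks) (conts a (b # ks) \<union> conts b ks)"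
| "conts (Cond v z a b) ks = insert (Cond v z a b # ks) (conts a ks \<union> conts b ks)"
| "conts (While v z a) ks = insert (While v z a # ks) (conts a (While v z a # ks))"

lemma finite_regs: "finite (regs c)"
  by (induction c) auto

lemma finite_conts: "finite (conts c ks)"
  by (induction c arbitrary: ks) auto

lemma Cons_in_conts: "c # ks \<in> conts c ks"
  by (cases c) auto

text \<open>A loop creates no new stacks, because its body runs on top of the stack from which the
  loop was entered. The only exit from \<open>conts c ks\<close> is \<open>ks\<close>.\<close>

lemma act_conts: "k \<in> conts c ks \<Longrightarrow> fst (act k f) \<in> insert ks (conts c ks)"
proof (induction c arbitrary: ks)
  case (Seq a b)
  then show ?case
    using Cons_in_conts[of a "b # ks"] Cons_in_conts[of b ks] by fastforce
next
  case (Cond v z a b)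
  then show ?case
    using Cons_in_conts[of a ks] Cons_in_conts[of b ks] by auto
next
  case (While v z a)
  then show ?case
    using Cons_in_conts[of a "While v z a # ks"] by (auto split: if_splits)
qed auto

lemma regs_conts: "k \<in> conts c ks \<Longrightarrow> \<Union> (regs ` set k) \<subseteq> regs c \<union> \<Union> (regs ` set ks)"
  by (induction c arbitrary: ks) fastforce+

text \<open>The machine passes \<open>(!) as\<close> to \<open>act\<close>, which is arbitrary from
  \<open>h\<close> on, whereas \<open>cstep\<close> passes the symbols of all registers. Both give
  the same action, since only registers that occur on the stack are inspected.\<close>

lemma act_cong:
  assumes "\<And>v. v \<in> \<Union> (regs ` set ks) \<Longrightarrow> f v = g v"
  shows "act ks f = act ks g"
proof (cases ks)
  case (Cons k ks')
  then show ?thesis using assms by (cases k) auto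
qed simp

section \<open>Simulation of commands by a Turing machine\<close>

datatype ctrl = Copy | Rewind | Run "cmd list" | Accept | Reject

text \<open>
  The input is copied to all tapes from left to right, the heads return and mark the left end, and
  then the program runs; its result is read off register 1.
\<close>

definition ctrl_step ::
  "nat \<Rightarrow> nat \<Rightarrow> cmd \<Rightarrow> ctrl \<Rightarrow> nat list \<Rightarrow> ctrl \<times> (nat \<times> move) list" where
  "ctrl_step h B c q as = (case q of
     Copy \<Rightarrow> if as ! 0 = 0 then (Rewind, replicate h (0, Move_Left))
       else (Copy, replicate h (if as ! 0 < B then Suc (as ! 0) else 0, Move_Right))
   | Rewind \<Rightarrow> if as ! 0 = 0 then (Run [c], replicate h (1, Stay))
       else (Rewind, map (\<lambda>a. (a, Move_Left)) as)
   | Run ks \<Rightarrow> if ks = [] then (if as ! 1 = 1 then Reject else Accept, map (\<lambda>a. (a, Stay)) as)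
       else (case act ks ((!) as) of (ks', mv) \<Rightarrow> (Run ks', map (\<lambda>i. (as ! i, mv i)) [0..<h]))
   | _ \<Rightarrow> (q, map (\<lambda>a. (a, Stay)) as))"

definition ctrls :: "cmd \<Rightarrow> ctrl set" where
  "ctrls c = {Copy, Rewind, Accept, Reject} \<union> Run ` insert [] (conts c [])"

definition machine :: "nat \<Rightarrow> nat \<Rightarrow> cmd \<Rightarrow> (ctrl \<Rightarrow> nat) \<Rightarrow> turing_machine" where
  "machine h B c e =
     \<lparr>tapes = h, states = card (ctrls c), symbols = Suc B, start = e Copy,
      accept = e Accept, reject = e Reject,
      transition = (\<lambda>q as. map_prod e id (ctrl_step h B c (inv_into (ctrls c) e q) as))\<rparr>"

lemma finite_ctrls: "finite (ctrls c)"
  by (simp add: ctrls_def finite_conts)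

lemma ctrl_step_ctrls: "q \<in> ctrls c \<Longrightarrow> fst (ctrl_step h B c q as) \<in> ctrls c"
proof (cases q)
  case (Run ks)
  assume "q \<in> ctrls c"
  then have "ks = [] \<or> fst (act ks ((!) as)) \<in> insert [] (conts c [])"
    using Run act_conts[of ks c "[]" "(!) as"] by (auto simp: ctrls_def)
  then show ?thesis
    using Run by (cases "act ks ((!) as)") (auto simp: ctrl_step_def ctrls_def)
qed (use Cons_in_conts[of c "[]"] in \<open>auto simp: ctrl_step_def ctrls_def\<close>)

text \<open>\<open>wf_tm\<close> asks about every tuple of symbols, including those that no run
  produces. The guard \<open>as ! 0 < B\<close> in \<open>ctrl_step\<close> takes care of the symbol
  \<open>B\<close>, whose shifted copy would leave the tape alphabet.\<close>

lemma ctrl_step_acts: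
  assumes "length as = h" "set as \<subseteq> {..<Suc B}" "1 \<le> B"
  shows "length (snd (ctrl_step h B c q as)) = h"
    and "\<forall>(b, d) \<in> set (snd (ctrl_step h B c q as)). b < Suc B"
proof -
  have "as ! i < Suc B" if "i < h" for i
    using assms(1,2) that by (metis lessThan_iff nth_mem subsetD)
  then show "length (snd (ctrl_step h B c q as)) = h"
    "\<forall>(b, d) \<in> set (snd (ctrl_step h B c q as)). b < Suc B"
    using assms by (auto simp: ctrl_step_def split: ctrl.splits prod.splits)
qed

text \<open>The marker occupies cell -1, so the register value \<open>v\<close> means head position
  \<open>v - 1\<close> and the copied input keeps its cells.\<close>

definition input_cells :: "nat list \<Rightarrow> int \<Rightarrow> nat" where
  "input_cells x i = (if i = - 1 then 1
     else if 0 \<le> i \<and> i < int (length x) then Suc (x ! nat i) else 0)"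

lemma input_cells_symb: "input_cells x (int v - 1) = symb x v"
  by (auto simp: input_cells_def symb_def nat_diff_distrib')

lemma map2_map_upt: "map2 f (map g [0..<n]) (map k [0..<n]) = map (\<lambda>i. f (g i) (k i)) [0..<n]"
  by (rule nth_equalityI) auto

lemma replicate_upt: "replicate n y = map (\<lambda>_. y) [0..<n]"
  by (simp add: map_replicate_const)

locale simulation =
  fixes h B :: nat and c :: cmd and e :: "ctrl \<Rightarrow> nat"
  assumes h: "2 \<le> h" and B: "1 \<le> B" and regs: "regs c \<subseteq> {..<h}"
    and e: "bij_betw e (ctrls c) {0..<card (ctrls c)}"
begin

abbreviation "M \<equiv> machine h B c e"

lemma e_less: "q \<in> ctrls c \<Longrightarrow> e q < card (ctrls c)"
  using e by (auto simp: bij_betw_def)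

lemma inv_e: "q \<in> ctrls c \<Longrightarrow> inv_into (ctrls c) e (e q) = q"
  using e by (simp add: bij_betw_def)

lemma e_eq_iff: "q \<in> ctrls c \<Longrightarrow> q' \<in> ctrls c \<Longrightarrow> e q = e q' \<longleftrightarrow> q = q'"
  using e by (auto simp: bij_betw_def inj_on_def)

lemma special_ctrls: "Copy \<in> ctrls c" "Rewind \<in> ctrls c" "Accept \<in> ctrls c" "Reject \<in> ctrls c"
  "Run [c] \<in> ctrls c" "Run [] \<in> ctrls c"
  using Cons_in_conts[of c "[]"] by (auto simp: ctrls_def)

lemma wf_machine: "wf_tm M"
proof -
  have *: "e (fst (ctrl_step h B c (inv_into (ctrls c) e q) as)) < card (ctrls c)"
    if "q < card (ctrls c)" for q as
  proof -
    have "inv_into (ctrls c) e q \<in> ctrls c"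
      by (intro inv_into_into) (use e that in \<open>simp add: bij_betw_def\<close>)
    then show ?thesis by (intro e_less ctrl_step_ctrls)
  qed
  have "case map_prod e id (ctrl_step h B c (inv_into (ctrls c) e q) as) of (q', acts) \<Rightarrow>
      q' < card (ctrls c) \<and> length acts = h \<and> (\<forall>(b, d) \<in> set acts. b < Suc B)"
    if "q < card (ctrls c)" "length as = h \<and> set as \<subseteq> {..<Suc B}" for q as
    using that(2) ctrl_step_acts[of as h B c "inv_into (ctrls c) e q"] B *[OF that(1), of as]
    by (cases "ctrl_step h B c (inv_into (ctrls c) e q) as") simp
  moreover have "e Accept \<noteq> e Reject"
    using special_ctrls by (simp add: e_eq_iff)
  ultimately show ?thesis
    unfolding wf_tm_def machine_def turing_machine.simps using h special_ctrls
    by (intro conjI allI impI e_less) auto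
qed

lemma tm_step_machine:
  assumes "q \<in> ctrls c" "q \<noteq> Accept" "q \<noteq> Reject"
  shows "tm_step M (e q, ts) =
    (e (fst (ctrl_step h B c q (map tape_read ts))),
     map2 tape_act ts (snd (ctrl_step h B c q (map tape_read ts))))"
  using assms special_ctrls
  by (simp add: tm_step_def machine_def inv_e e_eq_iff split: prod.splits)
     (simp add: map_prod_def split: prod.splits)

definition config :: "nat list \<Rightarrow> cmd list \<times> (nat \<Rightarrow> nat) \<Rightarrow> config" where
  "config x = (\<lambda>(ks, r). (e (Run ks), map (\<lambda>i. (input_cells x, int (r i) - 1)) [0..<h]))"

lemma tm_step_config:
  assumes ks: "ks \<in> conts c []"
  shows "tm_step M (config x (ks, r)) = config x (cstep x (ks, r))"
proof -
  let ?as = "map (\<lambda>i. symb x (r i)) [0..<h]"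
  have rd: "map tape_read (map (\<lambda>i. (input_cells x, int (r i) - 1)) [0..<h]) = ?as"
    by (simp add: tape_read_def input_cells_symb)
  obtain ks' mv where a: "act ks (\<lambda>i. symb x (r i)) = (ks', mv)" by fastforce
  have reg: "\<Union> (regs ` set ks) \<subseteq> {..<h}"
    using regs_conts[OF ks] regs by auto
  then have a': "act ks ((!) ?as) = (ks', mv)"
    unfolding a[symmetric] by (intro act_cong) auto
  have ne: "ks \<noteq> []"
  proof -
    have "k \<noteq> []" if "k \<in> conts c' l" for c' l k
      using that by (induction c' arbitrary: l) auto
    then show ?thesis using ks by blast
  qed
  \<comment> \<open>\<open>Dec\<close> stays on the marker 1, so the truncated subtraction in
    \<open>move_reg\<close> agrees with the integer head position.\<close>
  have mv: "r i > 0" if "mv i = Move_Left" for i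
    using a that ne
    by (cases ks; cases "hd ks") (auto simp: symb_def split: if_splits)
  have "Run ks \<in> ctrls c" using ks by (auto simp: ctrls_def)
  moreover have "ctrl_step h B c (Run ks) ?as = (Run ks', map (\<lambda>i. (symb x (r i), mv i)) [0..<h])"
    using ne a' by (simp add: ctrl_step_def)
  \<comment> \<open>A step writes back the symbol that it reads; only the heads move.\<close>
  moreover have "tape_act (input_cells x, int (r i) - 1) (symb x (r i), mv i) =
      (input_cells x, int (move_reg (mv i) (r i)) - 1)" for i
  proof -
    have "(input_cells x)(int (r i) - 1 := symb x (r i)) = input_cells x"
      by (simp add: input_cells_symb[symmetric])
    then show ?thesis using mv[of i]
      by (auto simp: tape_act_def move_reg_def of_nat_diff split: move.splits)
  qed
  ultimately show ?thesis
    using a by (simp add: config_def tm_step_machine rd cstep_def map2_map_upt del: map_map)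
qed

lemma cstep_conts:
  assumes "ks \<in> insert [] (conts c [])" and "(cstep x ^^ t) (ks, r) = (ks', r')"
  shows "ks' \<in> insert [] (conts c [])"
  using assms
proof (induction t arbitrary: ks' r')
  case (Suc t)
  obtain k1 r1 where 1: "(cstep x ^^ t) (ks, r) = (k1, r1)" by fastforce
  with Suc have k1: "k1 \<in> insert [] (conts c [])" by blast
  have "ks' = fst (act k1 (\<lambda>i. symb x (r1 i)))"
    using Suc.prems(2) 1 by (auto simp: cstep_def split: prod.splits)
  then show ?case using k1 act_conts[of k1 c "[]"] by auto
qed simp

text \<open>The step count is only bounded by \<open>t\<close> because an empty stack idles under
  \<open>cstep\<close>, while the machine in state \<open>Run []\<close> goes on to its
  verdict.\<close>

lemma tm_steps_config:
  assumes "(cstep x ^^ t) ([c], r) = ([], r')"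
  shows "\<exists>t' \<le> t. (tm_step M ^^ t') (config x ([c], r)) = config x ([], r')"
proof -
  have "\<exists>t' \<le> t. (tm_step M ^^ t') (config x ([c], r)) = config x ((cstep x ^^ t) ([c], r))"
    for t
  proof (induction t)
    case (Suc t)
    then obtain t' where t': "t' \<le> t"
      "(tm_step M ^^ t') (config x ([c], r)) = config x ((cstep x ^^ t) ([c], r))" by blast
    obtain k1 r1 where 1: "(cstep x ^^ t) ([c], r) = (k1, r1)" by fastforce
    then have k1: "k1 \<in> insert [] (conts c [])"
      using cstep_conts[OF _ 1] Cons_in_conts[of c "[]"] by auto
    show ?case
    proof (cases "k1 = []")
      case True
      then have "cstep x (k1, r1) = (k1, r1)" by (simp add: cstep_def move_reg_def)
      then show ?thesis using t' 1 by (auto intro!: exI[of _ t'])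
    next
      case False
      then show ?thesis using t' 1 k1 tm_step_config[of k1 x r1]
        by (auto intro!: exI[of _ "Suc t'"])
    qed
  qed auto
  then show ?thesis using assms by metis
qed

text \<open>Tape 0 is both source and target of the copying: beyond the first \<open>j\<close> cells
  it still holds the raw input, where the other tapes are blank.\<close>

definition copied :: "nat list \<Rightarrow> nat \<Rightarrow> nat \<Rightarrow> int \<Rightarrow> nat" where
  "copied x j t i = (if 0 \<le> i \<and> i < int j \<and> i < int (length x) then Suc (x ! nat i)
     else if t = 0 \<and> 0 \<le> i \<and> i < int (length x) then x ! nat i else 0)"

lemma copy_phase:
  assumes x: "set x \<subseteq> {0<..<B}" and j: "j \<le> length x"
  shows "(tm_step M ^^ j) (init_config M x) =
    (e Copy, map (\<lambda>t. (copied x j t, int j)) [0..<h])"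
  using j
proof (induction j)
  case 0
  have "input_tape x # replicate (h - 1) (\<lambda>_. 0, 0) = map (\<lambda>t. (copied x 0 t, int 0)) [0..<h]"
    by (rule nth_equalityI) (use h in \<open>auto simp: nth_Cons input_tape_def copied_def fun_eq_iff split: nat.splits\<close>)
  then show ?case by (simp add: init_config_def machine_def)
next
  case (Suc j)
  then have j: "j < length x" by simp
  then have xj: "0 < x ! j" "x ! j < B" using x nth_mem by fastforce+
  have r0: "map tape_read (map (\<lambda>t. (copied x j t, int j)) [0..<h]) ! 0 = x ! j"
    using h j by (simp add: tape_read_def copied_def)
  have "(copied x j t)(int j := Suc (x ! j)) = copied x (Suc j) t" for t
    using j by (auto simp: copied_def fun_eq_iff)
  then have "tape_act (copied x j t, int j) (Suc (x ! j), Move_Right) = (copied x (Suc j) t, int (Suc j))"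
    for t
    by (simp add: tape_act_def)
  moreover have "ctrl_step h B c Copy (map tape_read (map (\<lambda>t. (copied x j t, int j)) [0..<h])) =
      (Copy, replicate h (Suc (x ! j), Move_Right))"
    unfolding ctrl_step_def r0 using xj by simp
  moreover have "(tm_step M ^^ j) (init_config M x) =
      (e Copy, map (\<lambda>t. (copied x j t, int j)) [0..<h])"
    using Suc by simp
  ultimately show ?case
    using tm_step_machine[of Copy] special_ctrls
    by (simp add: replicate_upt map2_map_upt del: map_map)
qed

definition filled :: "nat list \<Rightarrow> int \<Rightarrow> nat" where
  "filled x i = (if 0 \<le> i \<and> i < int (length x) then Suc (x ! nat i) else 0)"

lemma rewind_phase:
  assumes "j \<le> length x"
  shows "(tm_step M ^^ j) (e Rewind, map (\<lambda>t. (filled x, int (length x) - 1)) [0..<h]) =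
    (e Rewind, map (\<lambda>t. (filled x, int (length x) - 1 - int j)) [0..<h])"
  using assms
proof (induction j)
  case (Suc j)
  let ?k = "int (length x) - 1 - int j"
  have rd: "map tape_read (map (\<lambda>t. (filled x, ?k)) [0..<h]) = map (\<lambda>_. filled x ?k) [0..<h]"
    by (simp add: tape_read_def)
  have "map (\<lambda>_. filled x ?k) [0..<h] ! 0 \<noteq> 0"
    using Suc.prems h by (simp add: filled_def)
  then have "ctrl_step h B c Rewind (map (\<lambda>_. filled x ?k) [0..<h]) =
      (Rewind, map (\<lambda>_. (filled x ?k, Move_Left)) [0..<h])"
    by (simp add: ctrl_step_def)
  moreover have "tape_act (filled x, ?k) (filled x ?k, Move_Left) = (filled x, ?k - 1)"
    by (simp add: tape_act_def)
  ultimately show ?case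
    using Suc tm_step_machine[of Rewind "map (\<lambda>t. (filled x, ?k)) [0..<h]"] special_ctrls
    unfolding rd by (simp add: map2_map_upt algebra_simps)
qed simp

text \<open>With \<open>n = length x\<close>, the count is \<open>n\<close> copying steps, one step
  at the blank after the input, \<open>n\<close> steps back, and one step that writes the
  marker.\<close>

lemma startup:
  assumes x: "set x \<subseteq> {0<..<B}"
  shows "(tm_step M ^^ (2 * length x + 2)) (init_config M x) = config x ([c], \<lambda>_. 0)"
proof -
  let ?n = "length x"
  have copied: "copied x ?n t = filled x" for t
    by (auto simp: copied_def filled_def fun_eq_iff)
  have rd: "map tape_read (map (\<lambda>t. (filled x, k)) [0..<h]) = map (\<lambda>_. filled x k) [0..<h]" for k
    by (simp add: tape_read_def)
  have 1: "tm_step M (e Copy, map (\<lambda>t. (filled x, int ?n)) [0..<h]) =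
      (e Rewind, map (\<lambda>t. (filled x, int ?n - 1)) [0..<h])"
  proof -
    have 0: "filled x (int ?n) = 0" by (simp add: filled_def)
    have "ctrl_step h B c Copy (map (\<lambda>_. 0) [0..<h]) = (Rewind, replicate h (0, Move_Left))"
      using h by (simp add: ctrl_step_def)
    moreover have "tape_act (filled x, int ?n) (0, Move_Left) = (filled x, int ?n - 1)"
      using 0 by (auto simp: tape_act_def fun_upd_idem_iff)
    ultimately show ?thesis
      using tm_step_machine[of Copy "map (\<lambda>t. (filled x, int ?n)) [0..<h]"] special_ctrls
      unfolding rd 0 by (simp add: map2_map_upt replicate_upt)
  qed
  have 2: "tm_step M (e Rewind, map (\<lambda>t. (filled x, - 1)) [0..<h]) = config x ([c], \<lambda>_. 0)"
  proof -
    have 0: "filled x (- 1) = 0" by (simp add: filled_def)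
    have "ctrl_step h B c Rewind (map (\<lambda>_. 0) [0..<h]) = (Run [c], replicate h (1, Stay))"
      using h by (simp add: ctrl_step_def)
    moreover have "(filled x)(- 1 := 1) = input_cells x"
      by (auto simp: filled_def input_cells_def fun_eq_iff)
    then have "tape_act (filled x, - 1) (1, Stay) = (input_cells x, - 1)"
      by (simp add: tape_act_def)
    ultimately show ?thesis
      using tm_step_machine[of Rewind "map (\<lambda>t. (filled x, - 1)) [0..<h]"] special_ctrls
      unfolding rd 0 by (simp add: map2_map_upt replicate_upt config_def)
  qed
  have "2 * ?n + 2 = Suc (?n + (Suc ?n))" by simp
  then have "(tm_step M ^^ (2 * ?n + 2)) (init_config M x) =
      tm_step M ((tm_step M ^^ ?n) (tm_step M ((tm_step M ^^ ?n) (init_config M x))))"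
    by (simp only: funpow.simps funpow_add o_apply)
  then show ?thesis
    by (simp add: copy_phase[OF x] copied 1 rewind_phase 2 del: map_map)
qed

lemma halts:
  assumes x: "set x \<subseteq> {0<..<B}" and run: "(cstep x ^^ t) ([c], \<lambda>_. 0) = ([], r)"
    and T: "2 * length x + 3 + t \<le> T"
  shows "fst ((tm_step M ^^ T) (init_config M x)) = (if r 1 \<noteq> 0 then accept M else reject M)"
proof -
  obtain t' where t': "t' \<le> t"
    "(tm_step M ^^ t') (config x ([c], \<lambda>_. 0)) = config x ([], r)"
    using tm_steps_config[OF run] by blast
  let ?q = "if r 1 \<noteq> 0 then Accept else Reject"
  \<comment> \<open>Input symbols are positive and hence stored as at least 2, so reading 1 shows
    that the register is 0.\<close>
  have x0: "x ! i \<noteq> 0" if "i < length x" for i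
    using x that nth_mem by fastforce
  have "symb x v = 1 \<longleftrightarrow> v = 0" for v
    using x0[of "v - 1"] by (auto simp: symb_def)
  then have "fst (tm_step M (config x ([], r))) = e ?q"
    using special_ctrls h
    by (simp add: config_def tm_step_machine ctrl_step_def tape_read_def input_cells_symb)
  then obtain ts where ts: "tm_step M (config x ([], r)) = (e ?q, ts)"
    by (metis prod.collapse)
  have halted: "(tm_step M ^^ k) (e ?q, ts) = (e ?q, ts)" for k
    by (induction k) (auto simp: tm_step_def machine_def)
  obtain k where k: "T = k + Suc (t' + (2 * length x + 2))"
  proof
    show "T = (T - Suc (t' + (2 * length x + 2))) + Suc (t' + (2 * length x + 2))"
      using T t'(1) by simp
  qed
  have "(tm_step M ^^ T) (init_config M x) = (tm_step M ^^ k) (tm_step M ((tm_step M ^^ t')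
      ((tm_step M ^^ (2 * length x + 2)) (init_config M x))))"
    unfolding k by (simp only: funpow.simps funpow_add o_apply)
  also have "\<dots> = (e ?q, ts)"
    unfolding startup[OF x] t'(2) ts halted ..
  finally show ?thesis by (simp add: machine_def)
qed

end

theorem poly_time_decidableI:
  assumes A: "finite A" "0 \<notin> A" "L \<subseteq> lists A"
    and run: "\<And>x. set x \<subseteq> A \<Longrightarrow>
      \<exists>t \<le> poly p (length x). \<exists>r. (cstep x ^^ t) ([c], \<lambda>_. 0) = ([], r) \<and> (r 1 \<noteq> 0 \<longleftrightarrow> x \<in> L)"
  shows "poly_time_decidable A L"
proof -
  obtain e where e: "bij_betw e (ctrls c) {0..<card (ctrls c)}"
    using ex_bij_betw_finite_nat[OF finite_ctrls] by blast
  \<comment> \<open>The second \<open>Suc\<close> guarantees a tape for register 1, from which the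
    result is read.\<close>
  define h where "h = Suc (Suc (Max (insert 0 (regs c))))"
  have h': "regs c \<subseteq> {..<h}" "2 \<le> h"
  proof
    fix v assume "v \<in> regs c"
    then have "v \<le> Max (insert 0 (regs c))" using finite_regs by simp
    then show "v \<in> {..<h}" by (simp add: h_def)
  qed (simp add: h_def)
  define B where "B = Suc (Max (insert 0 A))"
  have B': "A \<subseteq> {0<..<B}" "1 \<le> B"
  proof -
    have "a < B" if "a \<in> A" for a
      using that A(1) by (simp add: B_def less_Suc_eq_le)
    moreover have "0 < a" if "a \<in> A" for a
      using that A(2) by (cases a) auto
    ultimately show "A \<subseteq> {0<..<B}" by auto
  qed (simp add: B_def)
  interpret simulation h B c e
    by unfold_locales (fact h' B' e)+
  \<comment> \<open>The additional \<open>2 * n + 3\<close> steps are those of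
    \<open>startup\<close> and the final step out of \<open>Run []\<close>.\<close>
  have "decides_in_time M A L (poly (p + [:3, 2:]))"
    unfolding decides_in_time_def
  proof (intro allI impI)
    fix x assume x: "set x \<subseteq> A"
    obtain t r where t: "t \<le> poly p (length x)" "(cstep x ^^ t) ([c], \<lambda>_. 0) = ([], r)"
      "r 1 \<noteq> 0 \<longleftrightarrow> x \<in> L"
      using run[OF x] by (elim exE conjE) (rule that)
    moreover have "set x \<subseteq> {0<..<B}" using x B'(1) by (rule subset_trans)
    ultimately show "fst ((tm_step M ^^ poly (p + [:3, 2:]) (length x)) (init_config M x)) =
        (if x \<in> L then accept M else reject M)"
      using halts[of x t r "poly (p + [:3, 2:]) (length x)"] by auto
  qed
  moreover have "A \<subseteq> {..<symbols M}" using B' by (auto simp: machine_def)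
  ultimately show ?thesis
    using A wf_machine unfolding poly_time_decidable_def by blast
qed

section \<open>Bounded recursive terms\<close>

text \<open>
  Values lie in \<open>0, ..., n + 1\<close>. \<open>Iter f i m t u\<close> iterates \<open>u\<close> from \<open>t\<close> as often as \<open>m\<close> says, with
  accumulator \<open>f\<close> and loop counter \<open>i\<close> bound in \<open>u\<close>; for \<open>f = i\<close> the accumulator hides the counter.
\<close>

datatype tm = Var nat | One | Top | Add tm tm | Sub tm tm | IfSym tm nat tm tm
  | Iter nat nat tm tm tm

primrec sem :: "nat list \<Rightarrow> tm \<Rightarrow> (nat \<Rightarrow> nat) \<Rightarrow> nat" where
  "sem x (Var v) s = s v"
| "sem x One s = 1"
| "sem x Top s = Suc (length x)"
| "sem x (Add t u) s = min (Suc (length x)) (sem x t s + sem x u s)"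
| "sem x (Sub t u) s = sem x t s - sem x u s"
| "sem x (IfSym t a u v) s = (if symb x (sem x t s) = a then sem x u s else sem x v s)"
| "sem x (Iter f i m t u) s =
     fold (\<lambda>k y. sem x u (s(i := k, f := y))) [0..<sem x m s] (sem x t s)"

section \<open>Compilation of terms into commands\<close>

definition clear :: "nat \<Rightarrow> cmd" where
  "clear v = While v 1 (Dec v)"

definition transfer :: "nat \<Rightarrow> nat \<Rightarrow> cmd" where
  "transfer v w = Seq (clear w) (While v 1 (Seq (Dec v) (Inc w)))"

text \<open>A register is read by counting it down, which destroys it. So the value is moved to both
  \<open>w\<close> and \<open>z\<close>, and \<open>z\<close> then restores
  \<open>v\<close>.\<close>

definition duplicate :: "nat \<Rightarrow> nat \<Rightarrow> nat \<Rightarrow> cmd" where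
  "duplicate v w z = Seq (Seq (clear w) (clear z))
     (Seq (While v 1 (Seq (Dec v) (Seq (Inc w) (Inc z)))) (While z 1 (Seq (Dec z) (Inc v))))"

text \<open>
  Variable \<open>v\<close> lives in register \<open>\<rho> v < d\<close>; the code leaves the registers below \<open>d\<close> unchanged,
  uses those from \<open>d\<close> on as scratch space and puts the value into register \<open>d\<close>.
\<close>

primrec compile :: "tm \<Rightarrow> (nat \<Rightarrow> nat) \<Rightarrow> nat \<Rightarrow> cmd" where
  "compile (Var v) \<rho> d = duplicate (\<rho> v) d (Suc d)"
| "compile One \<rho> d = Seq (clear d) (Inc d)"
| "compile Top \<rho> d = While d 0 (Inc d)"
| "compile (Add t u) \<rho> d = Seq (compile t \<rho> d) (Seq (compile u \<rho> (d + 1))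
     (While (d + 1) 1 (Seq (Dec (d + 1)) (Inc d))))"
| "compile (Sub t u) \<rho> d = Seq (compile t \<rho> d) (Seq (compile u \<rho> (d + 1))
     (While (d + 1) 1 (Seq (Dec (d + 1)) (Dec d))))"
| "compile (IfSym t a u v) \<rho> d = Seq (compile t \<rho> d) (Cond d a (compile u \<rho> d) (compile v \<rho> d))"
| "compile (Iter f i m t u) \<rho> d = Seq (compile t \<rho> d) (Seq (clear (d + 1)) (Seq (compile m \<rho> (d + 2))
     (While (d + 2) 1 (Seq (Dec (d + 2)) (Seq (compile u (\<rho>(i := d + 1, f := d)) (d + 3))
       (Seq (transfer (d + 3) d) (Inc (d + 1))))))))"

text \<open>Quantifying over the remaining stack makes runs composable, and an upper bound in place
  of an exact count makes them monotone in \<open>t\<close>.\<close>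

definition runs :: "nat list \<Rightarrow> cmd \<Rightarrow> (nat \<Rightarrow> nat) \<Rightarrow> (nat \<Rightarrow> nat) \<Rightarrow> nat \<Rightarrow> bool" where
  "runs x c r r' t \<longleftrightarrow> (\<forall>ks. \<exists>t' \<le> t. (cstep x ^^ t') (c # ks, r) = (ks, r'))"

definition valid :: "nat list \<Rightarrow> (nat \<Rightarrow> nat) \<Rightarrow> bool" where
  "valid x r \<longleftrightarrow> (\<forall>v. r v \<le> Suc (length x))"

section \<open>Running times of commands\<close>

lemma runs_mono: "runs x c r r' t \<Longrightarrow> t \<le> t' \<Longrightarrow> runs x c r r' t'"
  unfolding runs_def by (meson order_trans)

lemma steps_trans:
  assumes "\<exists>t \<le> a. (f ^^ t) p = q" "\<exists>t \<le> b. (f ^^ t) q = z"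
  shows "\<exists>t \<le> a + b. (f ^^ t) p = (z :: 'a)"
proof -
  from assms obtain t u where "t \<le> a" "(f ^^ t) p = q" "u \<le> b" "(f ^^ u) q = z" by blast
  then show ?thesis by (intro exI[of _ "u + t"]) (auto simp: funpow_add)
qed

lemma steps_Suc:
  assumes "f p = q" "\<exists>t \<le> a. (f ^^ t) q = z"
  shows "\<exists>t \<le> Suc a. (f ^^ t) p = (z :: 'a)"
proof -
  have "\<exists>t \<le> 1. (f ^^ t) p = q" using assms(1) by (intro exI[of _ 1]) auto
  from steps_trans[OF this assms(2)] show ?thesis by simp
qed

lemma runs_Seq:
  assumes "runs x a r r1 t" "runs x b r1 r2 u"
  shows "runs x (Seq a b) r r2 (t + u + 1)"
  unfolding runs_def
proof
  fix ks
  have "\<exists>t' \<le> t + u. (cstep x ^^ t') (a # b # ks, r) = (ks, r2)"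
    by (rule steps_trans[of _ _ _ "(b # ks, r1)"]) (use assms in \<open>auto simp: runs_def\<close>)
  from steps_Suc[OF _ this] show "\<exists>t' \<le> t + u + 1. (cstep x ^^ t') (Seq a b # ks, r) = (ks, r2)"
    by (simp add: cstep_def move_reg_def)
qed

lemma runs_Cond:
  assumes "symb x (r v) = z \<Longrightarrow> runs x a r r1 t" "symb x (r v) \<noteq> z \<Longrightarrow> runs x b r r1 t"
  shows "runs x (Cond v z a b) r r1 (t + 1)"
  unfolding runs_def
proof
  fix ks
  have "\<exists>t' \<le> t. (cstep x ^^ t') ((if symb x (r v) = z then a else b) # ks, r) = (ks, r1)"
    using assms by (auto simp: runs_def)
  from steps_Suc[OF _ this] show "\<exists>t' \<le> t + 1. (cstep x ^^ t') (Cond v z a b # ks, r) = (ks, r1)"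
    by (simp add: cstep_def move_reg_def)
qed

lemma runs_While_done: "symb x (r v) = z \<Longrightarrow> runs x (While v z a) r r 1"
  unfolding runs_def by (auto intro!: exI[of _ 1] simp: cstep_def move_reg_def)

lemma runs_While_step:
  assumes "symb x (r v) \<noteq> z" "runs x a r r1 t" "runs x (While v z a) r1 r2 u"
  shows "runs x (While v z a) r r2 (t + u + 1)"
  unfolding runs_def
proof
  fix ks
  have "\<exists>t' \<le> t + u. (cstep x ^^ t') (a # While v z a # ks, r) = (ks, r2)"
    by (rule steps_trans[of _ _ _ "(While v z a # ks, r1)"]) (use assms in \<open>auto simp: runs_def\<close>)
  from steps_Suc[OF _ this] show "\<exists>t' \<le> t + u + 1. (cstep x ^^ t') (While v z a # ks, r) = (ks, r2)"
    using assms(1) by (simp add: cstep_def move_reg_def)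
qed

lemma runs_Inc:
  assumes "r v \<le> Suc (length x)"
  shows "runs x (Inc v) r (r(v := min (Suc (length x)) (Suc (r v)))) 1"
  using assms unfolding runs_def
  by (auto intro!: exI[of _ 1] simp: cstep_def move_reg_def symb_def fun_eq_iff min_def split: if_splits)

lemma symb_eq_1_iff: "0 \<notin> set x \<Longrightarrow> symb x v = 1 \<longleftrightarrow> v = 0"
proof -
  assume "0 \<notin> set x"
  then have "x ! (v - 1) \<noteq> 0" if "0 < v" "v \<le> length x"
    using that nth_mem[of "v - 1" x] by (metis One_nat_def Suc_le_lessD Suc_pred)
  then show ?thesis by (auto simp: symb_def)
qed

lemma symb_eq_0_iff: "symb x v = 0 \<longleftrightarrow> length x < v"
  by (auto simp: symb_def)

lemma runs_Dec:
  assumes "0 \<notin> set x"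
  shows "runs x (Dec v) r (r(v := r v - 1)) 1"
  using symb_eq_1_iff[OF assms, of "r v"] unfolding runs_def
  by (auto intro!: exI[of _ 1] simp: cstep_def move_reg_def fun_eq_iff)

text \<open>\<open>P j\<close> says that \<open>j\<close> rounds remain. A round costs one test and
  at most \<open>T\<close> steps, and the failing test at the end is one more step; at most
  \<open>length x + 1\<close> rounds give the bound.\<close>

lemma runs_While_count:
  assumes step: "\<And>j r. P (Suc j) r \<Longrightarrow> \<exists>r'. runs x a r r' T \<and> P j r'"
    and stop: "\<And>j r. P j r \<Longrightarrow> symb x (r v) = z \<longleftrightarrow> j = 0"
    and init: "P m r" "m \<le> Suc (length x)"
  shows "\<exists>r'. runs x (While v z a) r r' ((length x + 2) * (T + 1)) \<and> P 0 r'"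
proof -
  have "\<exists>r'. runs x (While v z a) r r' (m * (T + 1) + 1) \<and> P 0 r'"
    using init(1)
  proof (induction m arbitrary: r)
    case 0
    then show ?case using runs_While_done stop by fastforce
  next
    case (Suc m)
    obtain r1 where r1: "runs x a r r1 T" "P m r1" using step[OF Suc.prems] by blast
    obtain r2 where r2: "runs x (While v z a) r1 r2 (m * (T + 1) + 1)" "P 0 r2"
      using Suc.IH[OF r1(2)] by blast
    have "symb x (r v) \<noteq> z" using stop[OF Suc.prems] by simp
    from runs_While_step[OF this r1(1) r2(1)] r2(2) show ?case
      by (auto simp: algebra_simps)
  qed
  moreover have "m * (T + 1) + 1 \<le> Suc (length x) * (T + 1) + 1"
    using init(2) by (intro add_mono mult_le_mono1) auto
  then have "m * (T + 1) + 1 \<le> (length x + 2) * (T + 1)" by simp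
  ultimately show ?thesis using runs_mono by blast
qed

lemma runs_clear:
  assumes x: "0 \<notin> set x" and r: "valid x r"
  shows "runs x (clear v) r (r(v := 0)) (2 * length x + 4)"
proof -
  have "\<exists>r'. runs x (clear v) r r' ((length x + 2) * (1 + 1)) \<and> r' = r(v := 0)"
    unfolding clear_def
  proof (rule runs_While_count[where m = "r v" and P = "\<lambda>j r'. r' = r(v := j)"])
    fix j r' assume "r' = r(v := Suc j)"
    then show "\<exists>r''. runs x (Dec v) r' r'' 1 \<and> r'' = r(v := j)"
      using runs_Dec[OF x, of v r'] by simp
  qed (use symb_eq_1_iff[OF x] r in \<open>auto simp: valid_def\<close>)
  then show ?thesis by (auto elim!: runs_mono)
qed

lemma valid_upd: "valid x r \<Longrightarrow> y \<le> Suc (length x) \<Longrightarrow> valid x (r(v := y))"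
  by (simp add: valid_def)

lemma validD: "valid x r \<Longrightarrow> r v \<le> Suc (length x)"
  by (simp add: valid_def)

lemma runs_transfer:
  assumes x: "0 \<notin> set x" and r: "valid x r" and vw: "v \<noteq> w"
  shows "runs x (transfer v w) r (r(w := r v, v := 0)) (6 * length x + 13)"
proof -
  let ?r = "r(w := 0)"
  have "\<exists>r'. runs x (While v 1 (Seq (Dec v) (Inc w))) ?r r' ((length x + 2) * (3 + 1)) \<and>
      (0 \<le> r v \<and> r' = r(w := r v - 0, v := 0))"
  proof (rule runs_While_count[where m = "r v" and P = "\<lambda>j r'. j \<le> r v \<and> r' = r(w := r v - j, v := j)"])
    fix j r' assume r': "Suc j \<le> r v \<and> r' = r(w := r v - Suc j, v := Suc j)"
    \<comment> \<open>\<open>back_subst\<close> leaves the equality of the final register contents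
      as a goal of its own, to be proved pointwise.\<close>
    have "runs x (Seq (Dec v) (Inc w)) r' (r(w := r v - j, v := j)) (1 + 1 + 1)"
      by (rule runs_Seq[OF runs_Dec[OF x] runs_Inc[THEN back_subst[of "\<lambda>q. runs x _ _ q _"]]])
        (use r' vw validD[OF r, of v] in \<open>auto simp: fun_eq_iff\<close>)
    then show "\<exists>r''. runs x (Seq (Dec v) (Inc w)) r' r'' 3 \<and> j \<le> r v \<and> r'' = r(w := r v - j, v := j)"
      using r' by (auto simp: numeral_eq_Suc)
  qed (use symb_eq_1_iff[OF x] validD[OF r] vw in \<open>auto simp: fun_eq_iff\<close>)
  then have "runs x (While v 1 (Seq (Dec v) (Inc w))) ?r (r(w := r v, v := 0)) (4 * length x + 8)"
    by (auto elim!: runs_mono)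
  from runs_Seq[OF runs_clear[OF x r] this] show ?thesis
    unfolding transfer_def by (rule runs_mono) simp
qed

lemma runs_duplicate:
  assumes x: "0 \<notin> set x" and r: "valid x r" and d: "v \<noteq> w" "w \<noteq> z" "v \<noteq> z"
  shows "runs x (duplicate v w z) r (r(w := r v, z := 0)) (14 * length x + 31)"
proof -
  let ?r = "r(w := 0, z := 0)" and ?q = "r(w := r v, z := r v, v := 0)"
  have "\<exists>r'. runs x (While v 1 (Seq (Dec v) (Seq (Inc w) (Inc z)))) ?r r' ((length x + 2) * (5 + 1)) \<and>
      (0 \<le> r v \<and> r' = r(w := r v - 0, z := r v - 0, v := 0))"
  proof (rule runs_While_count[where m = "r v"
      and P = "\<lambda>j r'. j \<le> r v \<and> r' = r(w := r v - j, z := r v - j, v := j)"])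
    fix j r' assume r': "Suc j \<le> r v \<and> r' = r(w := r v - Suc j, z := r v - Suc j, v := Suc j)"
    have "runs x (Seq (Dec v) (Seq (Inc w) (Inc z))) r' (r(w := r v - j, z := r v - j, v := j))
        (1 + (1 + 1 + 1) + 1)"
      by (rule runs_Seq[OF runs_Dec[OF x] runs_Seq[OF runs_Inc runs_Inc[THEN back_subst[of "\<lambda>q. runs x _ _ q _"]]]])
        (use r' d validD[OF r, of v] in \<open>auto simp: fun_eq_iff\<close>)
    then show "\<exists>r''. runs x (Seq (Dec v) (Seq (Inc w) (Inc z))) r' r'' 5 \<and>
        j \<le> r v \<and> r'' = r(w := r v - j, z := r v - j, v := j)"
      using r' by (auto simp: numeral_eq_Suc)
  qed (use symb_eq_1_iff[OF x] validD[OF r] d in \<open>auto simp: fun_eq_iff\<close>)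
  then have 1: "runs x (While v 1 (Seq (Dec v) (Seq (Inc w) (Inc z)))) ?r ?q (6 * length x + 12)"
    by (auto elim!: runs_mono)
  have "\<exists>r'. runs x (While z 1 (Seq (Dec z) (Inc v))) ?q r' ((length x + 2) * (3 + 1)) \<and>
      (0 \<le> r v \<and> r' = r(w := r v, z := 0, v := r v - 0))"
  proof (rule runs_While_count[where m = "r v"
      and P = "\<lambda>j r'. j \<le> r v \<and> r' = r(w := r v, z := j, v := r v - j)"])
    fix j r' assume r': "Suc j \<le> r v \<and> r' = r(w := r v, z := Suc j, v := r v - Suc j)"
    have "runs x (Seq (Dec z) (Inc v)) r' (r(w := r v, z := j, v := r v - j)) (1 + 1 + 1)"
      by (rule runs_Seq[OF runs_Dec[OF x] runs_Inc[THEN back_subst[of "\<lambda>q. runs x _ _ q _"]]])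
        (use r' d validD[OF r, of v] in \<open>auto simp: fun_eq_iff\<close>)
    then show "\<exists>r''. runs x (Seq (Dec z) (Inc v)) r' r'' 3 \<and>
        j \<le> r v \<and> r'' = r(w := r v, z := j, v := r v - j)"
      using r' by (auto simp: numeral_eq_Suc)
  qed (use symb_eq_1_iff[OF x] validD[OF r] d in \<open>auto simp: fun_eq_iff\<close>)
  moreover have "r(w := r v, z := 0, v := r v) = r(w := r v, z := 0)"
    using d by (auto simp: fun_eq_iff)
  ultimately have 2: "runs x (While z 1 (Seq (Dec z) (Inc v))) ?q (r(w := r v, z := 0)) (4 * length x + 8)"
    by (auto elim!: runs_mono)
  have "valid x (r(w := 0))" using r by (simp add: valid_upd)
  from runs_Seq[OF runs_Seq[OF runs_clear[OF x r] runs_clear[OF x this]] runs_Seq[OF 1 2]]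
  show ?thesis unfolding duplicate_def by (rule runs_mono) simp
qed

section \<open>Correctness and running time of compiled terms\<close>

definition computes ::
  "nat list \<Rightarrow> tm \<Rightarrow> (nat \<Rightarrow> nat) \<Rightarrow> (nat \<Rightarrow> nat) \<Rightarrow> nat \<Rightarrow> nat \<Rightarrow> bool" where
  "computes x t s \<rho> d T \<longleftrightarrow>
     (\<forall>r. valid x r \<longrightarrow> (\<forall>v. \<rho> v < d \<and> r (\<rho> v) = s v) \<longrightarrow>
       (\<exists>r'. runs x (compile t \<rho> d) r r' T \<and> r' d = sem x t s \<and> (\<forall>i < d. r' i = r i) \<and> valid x r'))"

lemma computesI:
  assumes "\<And>r. valid x r \<Longrightarrow> (\<And>v. \<rho> v < d) \<Longrightarrow> (\<And>v. r (\<rho> v) = s v) \<Longrightarrow>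
    \<exists>r' T'. runs x (compile t \<rho> d) r r' T' \<and> T' \<le> T \<and> r' d = sem x t s \<and> (\<forall>i < d. r' i = r i) \<and> valid x r'"
  shows "computes x t s \<rho> d T"
  using assms unfolding computes_def by (meson runs_mono)

lemma computesE:
  assumes "computes x t s \<rho> d T" "valid x r" "\<And>v. \<rho> v < d" "\<And>v. r (\<rho> v) = s v"
  obtains r' where "runs x (compile t \<rho> d) r r' T" "r' d = sem x t s" "\<And>i. i < d \<Longrightarrow> r' i = r i" "valid x r'"
  using assms unfolding computes_def by blast

lemma runs_add_loop:
  assumes x: "0 \<notin> set x" and r: "valid x r" and vw: "v \<noteq> w"
  shows "runs x (While v 1 (Seq (Dec v) (Inc w))) r
    (r(w := min (Suc (length x)) (r w + r v), v := 0)) (4 * length x + 8)"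
proof -
  let ?N = "Suc (length x)"
  have rw: "min ?N (r w) = r w" using validD[OF r, of w] by simp
  have "\<exists>r'. runs x (While v 1 (Seq (Dec v) (Inc w))) r r' ((length x + 2) * (3 + 1)) \<and>
      (0 \<le> r v \<and> r' = r(w := min ?N (r w + (r v - 0)), v := 0))"
  proof (rule runs_While_count[where m = "r v"
        and P = "\<lambda>j r'. j \<le> r v \<and> r' = r(w := min ?N (r w + (r v - j)), v := j)"])
    fix j r' assume r': "Suc j \<le> r v \<and> r' = r(w := min ?N (r w + (r v - Suc j)), v := Suc j)"
    have "runs x (Seq (Dec v) (Inc w)) r' (r(w := min ?N (r w + (r v - j)), v := j)) (1 + 1 + 1)"
      by (rule runs_Seq[OF runs_Dec[OF x] runs_Inc[THEN back_subst[of "\<lambda>q. runs x _ _ q _"]]])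
        (use r' vw validD[OF r, of w] in \<open>auto simp: fun_eq_iff\<close>)
    then show "\<exists>r''. runs x (Seq (Dec v) (Inc w)) r' r'' 3 \<and>
        j \<le> r v \<and> r'' = r(w := min ?N (r w + (r v - j)), v := j)"
      using r' by (auto simp: numeral_eq_Suc)
  qed (use symb_eq_1_iff[OF x] validD[OF r] vw rw in \<open>auto simp: fun_eq_iff\<close>)
  then show ?thesis by (auto elim!: runs_mono)
qed

lemma runs_sub_loop:
  assumes x: "0 \<notin> set x" and r: "valid x r" and vw: "v \<noteq> w"
  shows "runs x (While v 1 (Seq (Dec v) (Dec w))) r (r(w := r w - r v, v := 0)) (4 * length x + 8)"
proof -
  have "\<exists>r'. runs x (While v 1 (Seq (Dec v) (Dec w))) r r' ((length x + 2) * (3 + 1)) \<and>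
      (0 \<le> r v \<and> r' = r(w := r w - (r v - 0), v := 0))"
  proof (rule runs_While_count[where m = "r v"
        and P = "\<lambda>j r'. j \<le> r v \<and> r' = r(w := r w - (r v - j), v := j)"])
    fix j r' assume r': "Suc j \<le> r v \<and> r' = r(w := r w - (r v - Suc j), v := Suc j)"
    have "runs x (Seq (Dec v) (Dec w)) r' (r(w := r w - (r v - j), v := j)) (1 + 1 + 1)"
      by (rule runs_Seq[OF runs_Dec[OF x] runs_Dec[OF x, THEN back_subst[of "\<lambda>q. runs x _ _ q _"]]])
        (use r' vw in \<open>auto simp: fun_eq_iff\<close>)
    then show "\<exists>r''. runs x (Seq (Dec v) (Dec w)) r' r'' 3 \<and>
        j \<le> r v \<and> r'' = r(w := r w - (r v - j), v := j)"
      using r' by (auto simp: numeral_eq_Suc)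
  qed (use symb_eq_1_iff[OF x] validD[OF r] vw in \<open>auto simp: fun_eq_iff\<close>)
  then show ?thesis by (auto elim!: runs_mono)
qed

lemma runs_top_loop:
  assumes r: "valid x r"
  shows "runs x (While d 0 (Inc d)) r (r(d := Suc (length x))) (2 * length x + 4)"
proof -
  let ?N = "Suc (length x)"
  have "\<exists>r'. runs x (While d 0 (Inc d)) r r' ((length x + 2) * (1 + 1)) \<and>
      (0 \<le> ?N \<and> r' = r(d := ?N - 0))"
  proof (rule runs_While_count[where m = "?N - r d" and P = "\<lambda>j r'. j \<le> ?N \<and> r' = r(d := ?N - j)"])
    fix j r' assume "Suc j \<le> ?N \<and> r' = r(d := ?N - Suc j)"
    then show "\<exists>r''. runs x (Inc d) r' r'' 1 \<and> j \<le> ?N \<and> r'' = r(d := ?N - j)"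
      using runs_Inc[of r' d x] by (auto simp: Suc_diff_le)
  qed (use symb_eq_0_iff validD[OF r, of d] in \<open>auto simp: fun_eq_iff\<close>)
  then show ?thesis by (auto elim!: runs_mono)
qed

lemma computes_Var:
  assumes "0 \<notin> set x"
  shows "computes x (Var v) s \<rho> d (14 * length x + 31)"
proof (rule computesI)
  fix r assume r: "valid x r" "\<And>v. \<rho> v < d" "\<And>v. r (\<rho> v) = s v"
  have "\<rho> v < d" by (rule r(2))
  then have "\<rho> v \<noteq> d" "d \<noteq> Suc d" "\<rho> v \<noteq> Suc d" by auto
  note runs_duplicate[OF assms r(1) this]
  moreover have "valid x (r(d := r (\<rho> v), Suc d := 0))"
    using r(1) by (intro valid_upd) (simp_all add: validD)
  ultimately show "\<exists>r' T'. runs x (compile (Var v) \<rho> d) r r' T' \<and> T' \<le> 14 * length x + 31 \<and> r' d = sem x (Var v) s \<and>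
      (\<forall>i < d. r' i = r i) \<and> valid x r'"
    using r unfolding compile.simps by (intro exI conjI) (assumption, auto)
qed

lemma computes_One:
  assumes "0 \<notin> set x"
  shows "computes x One s \<rho> d (2 * length x + 6)"
proof (rule computesI)
  fix r assume r: "valid x r" "\<And>v. \<rho> v < d" "\<And>v. r (\<rho> v) = s v"
  have "runs x (Inc d) (r(d := 0)) (r(d := 1)) 1"
    using runs_Inc[of "r(d := 0)" d x] by simp
  from runs_Seq[OF runs_clear[OF assms r(1)] this]
  show "\<exists>r' T'. runs x (compile One \<rho> d) r r' T' \<and> T' \<le> 2 * length x + 6 \<and> r' d = sem x One s \<and>
      (\<forall>i < d. r' i = r i) \<and> valid x r'"
    using r unfolding compile.simps by (intro exI conjI) (assumption, auto intro!: valid_upd)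
qed

lemma computes_Top: "computes x Top s \<rho> d (2 * length x + 4)"
proof (rule computesI)
  fix r assume r: "valid x r" "\<And>v. \<rho> v < d" "\<And>v. r (\<rho> v) = s v"
  from runs_top_loop[OF r(1), of d]
  show "\<exists>r' T'. runs x (compile Top \<rho> d) r r' T' \<and> T' \<le> 2 * length x + 4 \<and> r' d = sem x Top s \<and>
      (\<forall>i < d. r' i = r i) \<and> valid x r'"
    using r unfolding compile.simps by (intro exI conjI) (assumption, auto intro!: valid_upd)
qed

text \<open>The value of \<open>t\<close> waits in register \<open>d\<close>, which the code of
  \<open>u\<close> at \<open>d + 1\<close> leaves unchanged; the variables live below
  \<open>d\<close> and survive both evaluations.\<close>

lemma computes_Add_Sub:
  assumes x: "0 \<notin> set x" and t: "computes x t s \<rho> d T" and u: "computes x u s \<rho> (d + 1) U"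
  shows "computes x (Add t u) s \<rho> d (T + U + 4 * length x + 10)"
    and "computes x (Sub t u) s \<rho> d (T + U + 4 * length x + 10)"
proof -
  have *: "\<exists>r1 r2. runs x (compile t \<rho> d) r r1 T \<and> runs x (compile u \<rho> (d + 1)) r1 r2 U \<and>
      r2 d = sem x t s \<and> r2 (d + 1) = sem x u s \<and> (\<forall>i < d. r2 i = r i) \<and> valid x r2"
    if r: "valid x r" "\<And>v. \<rho> v < d" "\<And>v. r (\<rho> v) = s v" for r
  proof -
    obtain r1 where r1: "runs x (compile t \<rho> d) r r1 T" "r1 d = sem x t s" "\<And>i. i < d \<Longrightarrow> r1 i = r i" "valid x r1"
      by (rule computesE[OF t r]) blast
    have "\<And>v. \<rho> v < d + 1" "\<And>v. r1 (\<rho> v) = s v" using r r1(3) by (simp_all add: less_SucI)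
    then obtain r2 where r2: "runs x (compile u \<rho> (d + 1)) r1 r2 U" "r2 (d + 1) = sem x u s"
        "\<And>i. i < d + 1 \<Longrightarrow> r2 i = r1 i" "valid x r2"
      using computesE[OF u r1(4)] by blast
    from r1 r2 show ?thesis by (intro exI[of _ r1] exI[of _ r2]) auto
  qed
  show "computes x (Add t u) s \<rho> d (T + U + 4 * length x + 10)"
  proof (rule computesI)
    fix r assume r: "valid x r" "\<And>v. \<rho> v < d" "\<And>v. r (\<rho> v) = s v"
    obtain r1 r2 where 1: "runs x (compile t \<rho> d) r r1 T" "runs x (compile u \<rho> (d + 1)) r1 r2 U"
      "r2 d = sem x t s" "r2 (d + 1) = sem x u s" "\<forall>i < d. r2 i = r i" "valid x r2"
      using *[OF r] by blast
    have "d + 1 \<noteq> d" by simp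
    from runs_Seq[OF 1(1) runs_Seq[OF 1(2) runs_add_loop[OF x 1(6) this]]] 1
    show "\<exists>r' T'. runs x (compile (Add t u) \<rho> d) r r' T' \<and> T' \<le> T + U + 4 * length x + 10 \<and>
        r' d = sem x (Add t u) s \<and> (\<forall>i < d. r' i = r i) \<and> valid x r'"
      unfolding compile.simps by (intro exI conjI) (assumption, auto intro!: valid_upd)
  qed
  show "computes x (Sub t u) s \<rho> d (T + U + 4 * length x + 10)"
  proof (rule computesI)
    fix r assume r: "valid x r" "\<And>v. \<rho> v < d" "\<And>v. r (\<rho> v) = s v"
    obtain r1 r2 where 1: "runs x (compile t \<rho> d) r r1 T" "runs x (compile u \<rho> (d + 1)) r1 r2 U"
      "r2 d = sem x t s" "r2 (d + 1) = sem x u s" "\<forall>i < d. r2 i = r i" "valid x r2"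
      using *[OF r] by blast
    have "d + 1 \<noteq> d" "sem x t s - sem x u s \<le> Suc (length x)"
      using validD[OF 1(6), of d] 1(3) by auto
    from runs_Seq[OF 1(1) runs_Seq[OF 1(2) runs_sub_loop[OF x 1(6) this(1)]]] this(2) 1
    show "\<exists>r' T'. runs x (compile (Sub t u) \<rho> d) r r' T' \<and> T' \<le> T + U + 4 * length x + 10 \<and>
        r' d = sem x (Sub t u) s \<and> (\<forall>i < d. r' i = r i) \<and> valid x r'"
      unfolding compile.simps by (intro exI conjI) (assumption, auto intro!: valid_upd)
  qed
qed

lemma computes_IfSym:
  assumes t: "computes x t s \<rho> d T" and u: "computes x u s \<rho> d U" and v: "computes x v s \<rho> d V"
  shows "computes x (IfSym t a u v) s \<rho> d (T + U + V + 2)"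
proof (rule computesI)
  fix r assume r: "valid x r" "\<And>v. \<rho> v < d" "\<And>v. r (\<rho> v) = s v"
  obtain r1 where r1: "runs x (compile t \<rho> d) r r1 T" "r1 d = sem x t s" "\<And>i. i < d \<Longrightarrow> r1 i = r i" "valid x r1"
    by (rule computesE[OF t r]) blast
  have s: "\<And>v. r1 (\<rho> v) = s v" using r r1(3) by simp
  show "\<exists>r' T'. runs x (compile (IfSym t a u v) \<rho> d) r r' T' \<and> T' \<le> T + U + V + 2 \<and>
      r' d = sem x (IfSym t a u v) s \<and> (\<forall>i < d. r' i = r i) \<and> valid x r'"
  proof (cases "symb x (sem x t s) = a")
    case True
    obtain r2 where r2: "runs x (compile u \<rho> d) r1 r2 U" "r2 d = sem x u s" "\<And>i. i < d \<Longrightarrow> r2 i = r1 i" "valid x r2"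
      by (rule computesE[OF u r1(4) r(2) s]) blast
    have "runs x (Cond d a (compile u \<rho> d) (compile v \<rho> d)) r1 r2 (U + 1)"
      by (rule runs_Cond) (use r1 r2 True in auto)
    from runs_Seq[OF r1(1) this] show ?thesis
      unfolding compile.simps by (intro exI conjI) (assumption, use True r1 r2 in auto)
  next
    case False
    obtain r2 where r2: "runs x (compile v \<rho> d) r1 r2 V" "r2 d = sem x v s" "\<And>i. i < d \<Longrightarrow> r2 i = r1 i" "valid x r2"
      by (rule computesE[OF v r1(4) r(2) s]) blast
    have "runs x (Cond d a (compile u \<rho> d) (compile v \<rho> d)) r1 r2 (V + 1)"
      by (rule runs_Cond) (use r1 r2 False in auto)
    from runs_Seq[OF r1(1) this] show ?thesis
      unfolding compile.simps by (intro exI conjI) (assumption, use False r1 r2 in auto)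
  qed
qed

text \<open>The hypothesis on \<open>u\<close> ranges over all valid environments because counter
  and accumulator change in every round, while the bound \<open>U\<close> is common to all rounds.
  For \<open>f = i\<close> the later update wins in the environment and in the register map alike,
  so the accumulator hides the counter in both.\<close>

lemma computes_Iter:
  assumes x: "0 \<notin> set x" and s: "valid x s"
    and t: "computes x t s \<rho> d T" and m: "computes x m s \<rho> (d + 2) C"
    and u: "\<And>s. valid x s \<Longrightarrow> computes x u s (\<rho>(i := d + 1, f := d)) (d + 3) U"
  shows "computes x (Iter f i m t u) s \<rho> d (T + C + (length x + 2) * (U + 6 * length x + 19) + 2 * length x + 7)"
proof (rule computesI)
  fix r assume r: "valid x r" "\<And>v. \<rho> v < d" "\<And>v. r (\<rho> v) = s v"
  obtain r1 where r1: "runs x (compile t \<rho> d) r r1 T" "r1 d = sem x t s" "\<And>i. i < d \<Longrightarrow> r1 i = r i" "valid x r1"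
    by (rule computesE[OF t r]) blast
  let ?r = "r1(d + 1 := 0)"
  have r1': "valid x ?r" using r1(4) by (simp add: valid_upd)
  have 1: "\<And>v. \<rho> v < d + 2" "\<And>v. ?r (\<rho> v) = s v"
    using r r1(3) by (auto simp: less_SucI) (metis less_SucI nat_neq_iff)
  obtain r2 where r2: "runs x (compile m \<rho> (d + 2)) ?r r2 C" "r2 (d + 2) = sem x m s"
      "\<And>i. i < d + 2 \<Longrightarrow> r2 i = ?r i" "valid x r2"
    by (rule computesE[OF m r1' 1]) blast
  define M where "M = sem x m s"
  define F where "F k = fold (\<lambda>k y. sem x u (s(i := k, f := y))) [0..<k] (sem x t s)" for k
  \<comment> \<open>With \<open>j\<close> rounds left, register \<open>d\<close> holds the
    accumulator, \<open>d + 1\<close> the number of rounds done, and \<open>d + 2\<close> counts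
    down.\<close>
  define P where "P j r' \<longleftrightarrow> j \<le> M \<and> r' (d + 2) = j \<and> r' (d + 1) = M - j \<and> r' d = F (M - j) \<and>
      (\<forall>i < d. r' i = r i) \<and> valid x r'" for j r'
  have M: "M \<le> Suc (length x)" using validD[OF r2(4), of "d + 2"] unfolding r2(2) M_def .
  let ?body = "Seq (Dec (d + 2)) (Seq (compile u (\<rho>(i := d + 1, f := d)) (d + 3))
       (Seq (transfer (d + 3) d) (Inc (d + 1))))"
  have "\<exists>r'. runs x (While (d + 2) 1 ?body) r2 r' ((length x + 2) * ((U + 6 * length x + 18) + 1)) \<and> P 0 r'"
  proof (rule runs_While_count[where m = M and P = P])
    fix j r' assume r': "P (Suc j) r'"
    then have j: "Suc j \<le> M" by (simp add: P_def)
    let ?q = "r'(d + 2 := j)"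
    have q: "runs x (Dec (d + 2)) r' ?q 1"
      using runs_Dec[OF x, of "d + 2" r'] r' by (simp add: P_def)
    have vq: "valid x ?q" using r' j M by (auto simp: P_def intro!: valid_upd)
    let ?s = "s(i := M - Suc j, f := F (M - Suc j))"
    have "valid x ?s"
      using s validD[of x r' d] validD[of x r' "d + 1"] r' by (auto simp: P_def intro!: valid_upd)
    note u' = u[OF this]
    have "(\<rho>(i := d + 1, f := d)) v < d + 3" for v using r(2)[of v] by auto
    moreover have "?q ((\<rho>(i := d + 1, f := d)) v) = ?s v" for v
      using r' r(2,3)[of v] by (auto simp: P_def)
    ultimately obtain q2 where q2: "runs x (compile u (\<rho>(i := d + 1, f := d)) (d + 3)) ?q q2 U"
      "q2 (d + 3) = sem x u ?s" "\<And>i. i < d + 3 \<Longrightarrow> q2 i = ?q i" "valid x q2"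
      using computesE[OF u' vq] by blast
    have "d + 3 \<noteq> d" by simp
    note q3 = runs_transfer[OF x q2(4) this]
    let ?q3 = "q2(d := q2 (d + 3), d + 3 := 0)" and ?q4 = "q2(d := F (M - j), d + 3 := 0, d + 1 := M - j)"
    have FS: "F (M - j) = sem x u ?s"
      using j by (simp add: F_def flip: Suc_diff_Suc)
    have "?q3 (d + 1) = M - Suc j" using q2(3)[of "d + 1"] r' by (simp add: P_def)
    then have q4: "runs x (Inc (d + 1)) ?q3 ?q4 1"
      using runs_Inc[of ?q3 "d + 1" x] j M FS q2(2) by (simp add: Suc_diff_Suc)
    have "M - j \<le> Suc (length x)" using M by simp
    then have "P j ?q4"
      unfolding P_def using q2(3) r' j M FS q2(2) validD[OF q2(4), of "d + 3"]
      by (auto simp: P_def intro!: valid_upd q2(4))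
    moreover have "runs x ?body r' ?q4 (U + 6 * length x + 18)"
      by (rule runs_mono[OF runs_Seq[OF q runs_Seq[OF q2(1) runs_Seq[OF q3 q4]]]]) simp
    ultimately show "\<exists>r''. runs x ?body r' r'' (U + 6 * length x + 18) \<and> P j r''" by blast
  next
    show "P M r2" using r1 r2 by (auto simp: P_def M_def F_def)
  qed (use symb_eq_1_iff[OF x] M in \<open>auto simp: P_def\<close>)
  then obtain r3 where r3: "runs x (While (d + 2) 1 ?body) r2 r3 ((length x + 2) * ((U + 6 * length x + 18) + 1))"
    "P 0 r3" by blast
  from runs_Seq[OF r1(1) runs_Seq[OF runs_clear[OF x r1(4)] runs_Seq[OF r2(1) r3(1)]]] r3(2)
  show "\<exists>r' T'. runs x (compile (Iter f i m t u) \<rho> d) r r' T' \<and>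
      T' \<le> T + C + (length x + 2) * (U + 6 * length x + 19) + 2 * length x + 7 \<and>
      r' d = sem x (Iter f i m t u) s \<and> (\<forall>i < d. r' i = r i) \<and> valid x r'"
    unfolding compile.simps
    by (intro exI conjI) (assumption, auto simp: P_def M_def F_def)
qed

text \<open>The polynomial is chosen from \<open>t\<close> alone, before the input, the environment
  and the registers. Each \<open>Iter\<close> multiplies the bound of its body by
  \<open>length x + 2\<close>, so the degree is governed by the nesting depth of the term.\<close>

lemma computes_poly:
  "\<exists>p :: nat poly. \<forall>x s \<rho> d. 0 \<notin> set x \<longrightarrow> valid x s \<longrightarrow> computes x t s \<rho> d (poly p (length x))"
proof (induction t)
  case (Var v)
  show ?case using computes_Var by (intro exI[of _ "[:31, 14:]"]) (simp add: algebra_simps)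
next
  case One
  show ?case using computes_One by (intro exI[of _ "[:6, 2:]"]) (simp add: algebra_simps)
next
  case Top
  show ?case using computes_Top by (intro exI[of _ "[:4, 2:]"]) (simp add: algebra_simps)
next
  case (Add t u)
  then obtain p q where "\<forall>x s \<rho> d. 0 \<notin> set x \<longrightarrow> valid x s \<longrightarrow> computes x t s \<rho> d (poly p (length x))"
    "\<forall>x s \<rho> d. 0 \<notin> set x \<longrightarrow> valid x s \<longrightarrow> computes x u s \<rho> d (poly q (length x))" by blast
  then show ?case using computes_Add_Sub(1)
    by (intro exI[of _ "p + q + [:10, 4:]"]) (fastforce simp: algebra_simps)
next
  case (Sub t u)
  then obtain p q where "\<forall>x s \<rho> d. 0 \<notin> set x \<longrightarrow> valid x s \<longrightarrow> computes x t s \<rho> d (poly p (length x))"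
    "\<forall>x s \<rho> d. 0 \<notin> set x \<longrightarrow> valid x s \<longrightarrow> computes x u s \<rho> d (poly q (length x))" by blast
  then show ?case using computes_Add_Sub(2)
    by (intro exI[of _ "p + q + [:10, 4:]"]) (fastforce simp: algebra_simps)
next
  case (IfSym t a u v)
  then obtain p q q' where "\<forall>x s \<rho> d. 0 \<notin> set x \<longrightarrow> valid x s \<longrightarrow> computes x t s \<rho> d (poly p (length x))"
    "\<forall>x s \<rho> d. 0 \<notin> set x \<longrightarrow> valid x s \<longrightarrow> computes x u s \<rho> d (poly q (length x))"
    "\<forall>x s \<rho> d. 0 \<notin> set x \<longrightarrow> valid x s \<longrightarrow> computes x v s \<rho> d (poly q' (length x))" by blast
  then show ?case using computes_IfSym
    by (intro exI[of _ "p + q + q' + [:2:]"]) (fastforce simp: algebra_simps)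
next
  case (Iter f i m t u)
  then obtain p q q' where "\<forall>x s \<rho> d. 0 \<notin> set x \<longrightarrow> valid x s \<longrightarrow> computes x t s \<rho> d (poly p (length x))"
    "\<forall>x s \<rho> d. 0 \<notin> set x \<longrightarrow> valid x s \<longrightarrow> computes x m s \<rho> d (poly q (length x))"
    "\<forall>x s \<rho> d. 0 \<notin> set x \<longrightarrow> valid x s \<longrightarrow> computes x u s \<rho> d (poly q' (length x))" by blast
  then have "computes x (Iter f i m t u) s \<rho> d (poly p (length x) + poly q (length x) +
      (length x + 2) * (poly q' (length x) + 6 * length x + 19) + 2 * length x + 7)"
    if "0 \<notin> set x" "valid x s" for x s \<rho> d
    using that by (intro computes_Iter) auto
  then show ?case
    by (intro exI[of _ "p + q + [:2, 1:] * (q' + [:19, 6:]) + [:7, 2:]"]) (simp add: algebra_simps)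
qed

theorem poly_time_decidable_tm:
  assumes "finite A" "0 \<notin> A" "L \<subseteq> lists A"
    and t: "\<And>x. set x \<subseteq> A \<Longrightarrow> sem x t (\<lambda>_. 0) \<noteq> 0 \<longleftrightarrow> x \<in> L"
  shows "poly_time_decidable A L"
proof -
  obtain p where p: "\<And>x s \<rho> d. 0 \<notin> set x \<Longrightarrow> valid x s \<Longrightarrow> computes x t s \<rho> d (poly p (length x))"
    using computes_poly by blast
  show ?thesis
  proof (rule poly_time_decidableI[OF assms(1-3)])
    fix x assume x: "set x \<subseteq> A"
    then have "0 \<notin> set x" using assms(2) by blast
    \<comment> \<open>All free variables share register 0, which holds 0. Scratch space starts at
      register 1, so the result lands where the machine looks for it.\<close>
    then have "computes x t (\<lambda>_. 0) (\<lambda>_. 0) 1 (poly p (length x))"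
      by (intro p) (simp_all add: valid_def)
    then obtain r' where r': "runs x (compile t (\<lambda>_. 0) 1) (\<lambda>_. 0) r' (poly p (length x))"
      "r' 1 = sem x t (\<lambda>_. 0)"
      by (rule computesE[where r = "\<lambda>_. 0"]) (auto simp: valid_def)
    then show "\<exists>k \<le> poly p (length x). \<exists>r. (cstep x ^^ k) ([compile t (\<lambda>_. 0) 1], \<lambda>_. 0) = ([], r) \<and>
        (r 1 \<noteq> 0 \<longleftrightarrow> x \<in> L)"
      using t[OF x] unfolding runs_def by metis
  qed
qed

section \<open>The game\<close>

text \<open>
  After \<open>i\<close> iterations the marked occurrences of the letter \<open>a\<close> in \<open>p\<close> are exactly those before
  position \<open>fill p w a i\<close> together with the green ones, because yellow always goes to the first
  unmarked occurrence. Hence a single pointer replaces the whole partial marking.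
\<close>

primrec fill :: "'a list \<Rightarrow> 'a list \<Rightarrow> 'a \<Rightarrow> nat \<Rightarrow> nat" where
  "fill p w a 0 = 0"
| "fill p w a (Suc i) = (if w ! i = a \<and> p ! i \<noteq> a
     then Suc (LEAST j. length p \<le> j \<or> fill p w a i \<le> j \<and> p ! j = a \<and> \<not> (j < i \<and> w ! j = a))
     else fill p w a i)"

text \<open>Green may overwrite yellow, but nothing is ever unmarked, so the positions green after
  \<open>i\<close> iterations are the matching ones below \<open>i\<close>. If no unmarked
  occurrence of a letter is left, the default \<open>length p\<close> of the minimum in
  \<open>fill\<close> drives the pointer past the word, which is consistent as all its occurrences
  are marked.\<close>

lemma fold_mark_step:
  assumes "i \<le> length p" "j < length p"
  shows "fold (mark_step p w) [0..<i] (\<lambda>_. None) j = Some Green \<longleftrightarrow> j < i \<and> w ! j = p ! j"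
    and "fold (mark_step p w) [0..<i] (\<lambda>_. None) j \<noteq> None \<longleftrightarrow>
      j < fill p w (p ! j) i \<or> j < i \<and> w ! j = p ! j"
proof -
  let ?m = "\<lambda>i. fold (mark_step p w) [0..<i] (\<lambda>_. None)"
  have "\<forall>j < length p. (?m i j = Some Green \<longleftrightarrow> j < i \<and> w ! j = p ! j) \<and>
      (?m i j \<noteq> None \<longleftrightarrow> j < fill p w (p ! j) i \<or> j < i \<and> w ! j = p ! j)"
    using assms(1)
  proof (induction i)
    case (Suc i)
    have IH: "?m i j = Some Green \<longleftrightarrow> j < i \<and> w ! j = p ! j"
      "?m i j \<noteq> None \<longleftrightarrow> j < fill p w (p ! j) i \<or> j < i \<and> w ! j = p ! j" if "j < length p" for j
      using Suc.IH Suc.prems that by simp_all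
    have m: "?m (Suc i) = mark_step p w i (?m i)" by simp
    show ?case
    proof (cases "w ! i = p ! i")
      case True
      then have "?m (Suc i) = (?m i)(i := Some Green)" unfolding m by (simp add: mark_step_def)
      moreover have "fill p w a (Suc i) = fill p w a i" for a using True by simp
      ultimately have "(?m (Suc i) j = Some Green \<longleftrightarrow> j < Suc i \<and> w ! j = p ! j) \<and>
          (?m (Suc i) j \<noteq> None \<longleftrightarrow> j < fill p w (p ! j) (Suc i) \<or> j < Suc i \<and> w ! j = p ! j)"
        if j: "j < length p" for j
        using IH[OF j] True by (cases "j = i") (simp_all add: less_Suc_eq del: upt_Suc fill.simps)
      then show ?thesis by blast
    next
      case False
      define Q where "Q j \<longleftrightarrow> p ! j = w ! i \<and> \<not> (j < i \<and> w ! j = w ! i)" for j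
      define f where "f = fill p w (w ! i) i"
      define S where "S = {j. j < length p \<and> p ! j = w ! i \<and> ?m i j = None}"
      define L where "L = (LEAST j. length p \<le> j \<or> f \<le> j \<and> Q j)"
      have S: "S = {j. f \<le> j \<and> j < length p \<and> Q j}"
      proof -
        have "?m i j = None \<longleftrightarrow> f \<le> j \<and> \<not> (j < i \<and> w ! j = w ! i)" if "j < length p" "p ! j = w ! i" for j
          using IH(2)[OF that(1)] that(2) by (auto simp: f_def not_less)
        then show ?thesis by (auto simp: S_def Q_def)
      qed
      have "length p \<le> length p \<or> f \<le> length p \<and> Q (length p)" by simp
      then have L: "length p \<le> L \<or> f \<le> L \<and> Q L"
        unfolding L_def by (rule LeastI)
      have L': "\<not> (f \<le> j \<and> Q j) \<and> j < length p" if "j < L" for j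
        using not_less_Least[of j "\<lambda>j. length p \<le> j \<or> f \<le> j \<and> Q j"] that by (auto simp: L_def)
      have fill: "fill p w a (Suc i) = (if a = w ! i then Suc L else fill p w a i)" for a
        using False by (auto simp: L_def f_def Q_def)
      have mS: "?m (Suc i) = (if S \<noteq> {} then (?m i)(Min S := Some Yellow) else ?m i)"
        unfolding m mark_step_def Let_def S_def by (simp only: False if_False)
      show ?thesis
      proof (cases "L < length p")
        case True
        then have LS: "L \<in> S" using L unfolding S by auto
        have "finite S" unfolding S by simp
        then have "Min S = L"
          using LS L' unfolding S by (intro Min_eqI) (auto simp: not_less[symmetric])
        then have m': "?m (Suc i) = (?m i)(L := Some Yellow)" using LS mS by auto
        have pL: "p ! L = w ! i" "?m i L = None" using LS by (auto simp: S_def)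
        show ?thesis
        proof (intro allI impI)
          fix j assume j: "j < length p"
          show "(?m (Suc i) j = Some Green \<longleftrightarrow> j < Suc i \<and> w ! j = p ! j) \<and>
            (?m (Suc i) j \<noteq> None \<longleftrightarrow> j < fill p w (p ! j) (Suc i) \<or> j < Suc i \<and> w ! j = p ! j)"
          proof (cases "p ! j = w ! i")
            case pj: True
            show ?thesis
            proof (cases "j = L")
              case jL: True
              then show ?thesis unfolding m' fill using IH[OF j] pL False
                by (auto simp: less_Suc_eq)
            next
              case jL: False
              \<comment> \<open>From the old pointer \<open>f\<close> up to \<open>L\<close> every
                occurrence of the letter is already green, so moving the pointer beyond
                \<open>L\<close> marks nothing new except \<open>L\<close>.\<close>
              have "j < f \<or> j < i \<and> w ! j = p ! j \<longleftrightarrow> j < L \<or> j < i \<and> w ! j = p ! j"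
                using L L'[of j] True pj by (auto simp: Q_def)
              then show ?thesis unfolding m' fill using IH[OF j] jL False pj
                by (auto simp: less_Suc_eq f_def)
            qed
          next
            case pj: False
            then have "j \<noteq> L" using pL by auto
            then show ?thesis unfolding m' fill using IH[OF j] pj False
              by (auto simp: less_Suc_eq)
          qed
        qed
      next
        case nL: False
        have "S = {}" unfolding S using L' nL by force
        then have m': "?m (Suc i) = ?m i" using mS by simp
        have "?m i j \<noteq> None" if "j < length p" "p ! j = w ! i" for j
          using \<open>S = {}\<close> that by (auto simp: S_def)
        then have "(?m (Suc i) j = Some Green \<longleftrightarrow> j < Suc i \<and> w ! j = p ! j) \<and>
          (?m (Suc i) j \<noteq> None \<longleftrightarrow> j < fill p w (p ! j) (Suc i) \<or> j < Suc i \<and> w ! j = p ! j)"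
          if j: "j < length p" for j
          unfolding m' fill using IH[OF j] nL False j
          by (cases "p ! j = w ! i") (auto simp: less_Suc_eq simp del: not_None_eq)
        then show ?thesis by blast
      qed
    qed
  qed simp
  then show "?m i j = Some Green \<longleftrightarrow> j < i \<and> w ! j = p ! j"
    "?m i j \<noteq> None \<longleftrightarrow> j < fill p w (p ! j) i \<or> j < i \<and> w ! j = p ! j"
    using assms(2) by auto
qed

lemma length_marking [simp]: "length (marking p w) = length p"
  by (simp add: marking_def Let_def)

lemma marking_nth:
  assumes "j < length p"
  shows "marking p w ! j = Green \<longleftrightarrow> w ! j = p ! j"
    and "marking p w ! j = Gray \<longleftrightarrow> \<not> j < fill p w (p ! j) (length p) \<and> w ! j \<noteq> p ! j"
proof -
  let ?m = "fold (mark_step p w) [0..<length p] (\<lambda>_. None)"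
  \<comment> \<open>The fold writes only green and yellow, so gray can only come from
    \<open>None\<close>.\<close>
  have no_gray: "fold (mark_step p w) is m j \<noteq> Some Gray" if "m j \<noteq> Some Gray" for "is" m
    using that by (induction "is" arbitrary: m) (auto simp: mark_step_def Let_def)
  have "marking p w ! j = (case ?m j of None \<Rightarrow> Gray | Some c \<Rightarrow> c)"
    using assms by (simp add: marking_def Let_def)
  moreover note fold_mark_step[of "length p" p j w] no_gray[of "\<lambda>_. None" "[0..<length p]"]
  ultimately show "marking p w ! j = Green \<longleftrightarrow> w ! j = p ! j"
    "marking p w ! j = Gray \<longleftrightarrow> \<not> j < fill p w (p ! j) (length p) \<and> w ! j \<noteq> p ! j"
    using assms by (auto split: option.splits)
qed

text \<open>Being green and being gray together determine a mark, and both are comparisons of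
  letters or of a position with a pointer. In this form the equality of markings enters the
  formula.\<close>

lemma marking_eq_iff:
  "marking p v = marking p w \<longleftrightarrow> (\<forall>j < length p. (v ! j = p ! j \<longleftrightarrow> w ! j = p ! j) \<and>
     (v ! j \<noteq> p ! j \<longrightarrow>
       (j < fill p v (p ! j) (length p) \<longleftrightarrow> j < fill p w (p ! j) (length p))))"
proof -
  have mark_eq: "a = b \<longleftrightarrow> (a = Green \<longleftrightarrow> b = Green) \<and> (a = Gray \<longleftrightarrow> b = Gray)" for a b
    by (cases a; cases b) auto
  have "marking p v = marking p w \<longleftrightarrow> (\<forall>j < length p. marking p v ! j = marking p w ! j)"
    by (auto simp: list_eq_iff_nth_eq)
  also have "\<dots> \<longleftrightarrow> (\<forall>j < length p. (v ! j = p ! j \<longleftrightarrow> w ! j = p ! j) \<and>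
     (v ! j \<noteq> p ! j \<longrightarrow>
       (j < fill p v (p ! j) (length p) \<longleftrightarrow> j < fill p w (p ! j) (length p))))"
    by (subst mark_eq) (auto simp: marking_nth)
  finally show ?thesis .
qed

lemma marking_self_eq:
  assumes "marking p w = marking p p" "length w = length p"
  shows "w = p"
  using assms by (auto simp: marking_eq_iff intro!: nth_equalityI)

text \<open>\<open>C\<close> is the set of the words that are still possible; the word \<open>w\<close> stands for the marking that it causes.\<close>

primrec wins :: "'a list set \<Rightarrow> nat \<Rightarrow> 'a list set \<Rightarrow> bool" where
  "wins D 0 C \<longleftrightarrow> False"
| "wins D (Suc l) C \<longleftrightarrow>
     (\<exists>p \<in> D. \<forall>w \<in> C. w \<noteq> p \<longrightarrow> wins D l {v \<in> C. marking p v = marking p w})"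

text \<open>\<open>feedback\<close> appends the newest marking, whereas \<open>wins\<close> recurses
  on the first guess; this splits off the first marking and leaves a play of the residual
  strategy.\<close>

lemma feedback_Suc_Cons:
  "feedback s w (Suc n) = marking (s []) w # feedback (\<lambda>h. s (marking (s []) w # h)) w n"
  by (induction n) auto

text \<open>Forwards, a strategy is chosen for each marking, and these are glued together along the
  first marking received. \<open>C \<noteq> {}\<close> matters at \<open>l = 0\<close>, where the
  condition on strategies could hold vacuously while \<open>wins\<close> is false; it is inherited
  because a class contains the word that defines it.\<close>

lemma wins_iff_strategy:
  assumes "C \<noteq> {}" "C \<subseteq> D" "\<forall>w \<in> D. length w = k"
  shows "wins D l C \<longleftrightarrow> (\<exists>s. (\<forall>h. s h \<in> D) \<and> (\<forall>w \<in> C. \<exists>n < l. s (feedback s w n) = w))"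
  using assms(1,2)
proof (induction l arbitrary: C)
  case (Suc l)
  show ?case
  proof
    assume "wins D (Suc l) C"
    then obtain p where p: "p \<in> D"
      "\<And>w. w \<in> C \<Longrightarrow> w \<noteq> p \<Longrightarrow> wins D l {v \<in> C. marking p v = marking p w}" by auto
    have "\<exists>s. (\<forall>h. s h \<in> D) \<and>
        (\<forall>v \<in> C. v \<noteq> p \<and> marking p v = m \<longrightarrow> (\<exists>n < l. s (feedback s v n) = v))" for m
    proof (cases "\<exists>w \<in> C. w \<noteq> p \<and> marking p w = m")
      case True
      then obtain w where w: "w \<in> C" "w \<noteq> p" "m = marking p w" by blast
      have "{v \<in> C. marking p v = marking p w} \<noteq> {}" "{v \<in> C. marking p v = marking p w} \<subseteq> D"
        using w Suc.prems by auto
      from Suc.IH[OF this, THEN iffD1, OF p(2)[OF w(1,2)]]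
      obtain s where "\<forall>h. s h \<in> D"
        "\<forall>v \<in> {v \<in> C. marking p v = marking p w}. \<exists>n < l. s (feedback s v n) = v"
        by (elim exE conjE) (rule that)
      then show ?thesis using w(3) by (intro exI[of _ s]) simp
    next
      \<comment> \<open>A marking that no candidate other than \<open>p\<close> produces still needs
        some strategy with guesses in \<open>D\<close>.\<close>
      case False
      then show ?thesis using p(1) by (intro exI[of _ "\<lambda>_. p"]) blast
    qed
    then have "\<forall>m. \<exists>s. (\<forall>h. s h \<in> D) \<and>
        (\<forall>v \<in> C. v \<noteq> p \<and> marking p v = m \<longrightarrow> (\<exists>n < l. s (feedback s v n) = v))" ..
    from choice[OF this] obtain S where S': "\<forall>m. (\<forall>h. S m h \<in> D) \<and>
        (\<forall>v \<in> C. v \<noteq> p \<and> marking p v = m \<longrightarrow> (\<exists>n < l. S m (feedback (S m) v n) = v))" ..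
    then have S: "S m h \<in> D" "v \<in> C \<Longrightarrow> v \<noteq> p \<Longrightarrow> marking p v = m \<Longrightarrow>
      \<exists>n < l. S m (feedback (S m) v n) = v" for m h v by simp_all
    define s where "s h = (case h of [] \<Rightarrow> p | m # h' \<Rightarrow> S m h')" for h
    have s: "s [] = p" "\<And>m. (\<lambda>h. s (m # h)) = S m" by (simp_all add: s_def)
    have "\<exists>n < Suc l. s (feedback s w n) = w" if w: "w \<in> C" for w
    proof (cases "w = p")
      case True
      then show ?thesis using s(1) by (intro exI[of _ 0]) simp
    next
      case False
      obtain n where n: "n < l" "S (marking p w) (feedback (S (marking p w)) w n) = w"
        using S(2)[OF w False refl] by blast
      have "s (feedback s w (Suc n)) = s (marking p w # feedback (S (marking p w)) w n)"
        unfolding feedback_Suc_Cons s ..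
      also have "\<dots> = w" using n(2) by (simp add: s_def)
      finally show ?thesis using n(1) by (intro exI[of _ "Suc n"]) simp
    qed
    moreover have "s h \<in> D" for h using S(1) p(1) by (simp add: s_def split: list.splits)
    ultimately show "\<exists>s. (\<forall>h. s h \<in> D) \<and> (\<forall>w \<in> C. \<exists>n < Suc l. s (feedback s w n) = w)" by blast
  next
    assume "\<exists>s. (\<forall>h. s h \<in> D) \<and> (\<forall>w \<in> C. \<exists>n < Suc l. s (feedback s w n) = w)"
    then obtain s where s: "\<And>h. s h \<in> D" "\<And>w. w \<in> C \<Longrightarrow> \<exists>n < Suc l. s (feedback s w n) = w" by blast
    let ?p = "s []"
    have "wins D l {v \<in> C. marking ?p v = marking ?p w}" if w: "w \<in> C" "w \<noteq> ?p" for w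
    proof -
      let ?s = "\<lambda>h. s (marking ?p w # h)"
      have "\<exists>n < l. ?s (feedback ?s v n) = v" if v: "v \<in> C" "marking ?p v = marking ?p w" for v
      proof -
        obtain n where n: "n < Suc l" "s (feedback s v n) = v" using s(2)[OF v(1)] by blast
        show ?thesis
        proof (cases n)
          \<comment> \<open>If the first guess were \<open>v\<close>, the marking shared with
            \<open>w\<close> would be all green, and \<open>w\<close> would be that guess as
            well.\<close>
          case 0
          then have "?p = v" using n(2) by simp
          then have "marking ?p w = marking ?p ?p" using v(2)[symmetric] by metis
          moreover have "w \<in> D" "?p \<in> D" using w(1) Suc.prems(2) s(1) by blast+
          then have "length w = length ?p" using assms(3) by metis
          ultimately have "w = ?p" by (rule marking_self_eq)
          then show ?thesis using w(2) by contradiction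
        next
          case (Suc n')
          have "?s (feedback ?s v n') = v"
            using n(2) unfolding Suc feedback_Suc_Cons v(2) .
          moreover have "n' < l" using n(1) Suc by simp
          ultimately show ?thesis by (intro exI[of _ n'] conjI)
        qed
      qed
      then have *: "(\<forall>h. ?s h \<in> D) \<and>
          (\<forall>v \<in> {v \<in> C. marking ?p v = marking ?p w}. \<exists>n < l. ?s (feedback ?s v n) = v)"
        by (intro conjI allI ballI s(1)) (elim CollectE conjE)
      have "{v \<in> C. marking ?p v = marking ?p w} \<noteq> {}"
        "{v \<in> C. marking ?p v = marking ?p w} \<subseteq> D" using w Suc.prems by auto
      from Suc.IH[OF this, THEN iffD2, OF exI, OF *] show ?thesis .
    qed
    then show "wins D (Suc l) C"
      unfolding wins.simps by (intro bexI[of _ ?p] ballI impI s(1))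
  qed
qed simp

lemma guesser_wins_iff_wins:
  assumes "D \<noteq> {}" "\<forall>w \<in> D. length w = k"
  shows "guesser_wins D l \<longleftrightarrow> wins D l D"
  using wins_iff_strategy[OF assms(1) order_refl assms(2)]
  by (simp add: guesser_wins_def winning_strategy_def)

text \<open>\<open>A i\<close> contains the letters still possible at position \<open>i\<close>; guessing any word of \<open>C\<close> shrinks all \<open>A i\<close> with at least two elements.\<close>

lemma wins_few_letters:
  assumes "D \<noteq> {}" "C \<subseteq> D" "\<forall>w \<in> C. length w = k" "\<forall>w \<in> C. \<forall>i < k. w ! i \<in> A i"
    "\<forall>i < k. finite (A i) \<and> card (A i) \<le> Suc l"
  shows "wins D (Suc l) C"
  using assms(2-)
proof (induction l arbitrary: C A)
  case 0
  show ?case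
  proof (cases "C = {}")
    case False
    then obtain p where p: "p \<in> C" by blast
    have "w = p" if "w \<in> C" for w
    proof (rule nth_equalityI)
      fix i assume "i < length w"
      then have "i < k" "finite (A i)" "card (A i) \<le> 1" "w ! i \<in> A i" "p ! i \<in> A i"
        using 0 that p by auto
      then show "w ! i = p ! i" by (simp add: card_le_Suc0_iff_eq)
    qed (use 0 that p in auto)
    then show ?thesis using p 0 by auto
  qed (use assms(1) in auto)
next
  case (Suc l)
  show ?case
  proof (cases "C = {}")
    case False
    then obtain p where p: "p \<in> C" by blast
    have "wins D (Suc l) {v \<in> C. marking p v = marking p w}" if w: "w \<in> C" "w \<noteq> p" for w
    proof (rule Suc.IH)
      \<comment> \<open>All words of the class agree with \<open>w\<close> on where \<open>p\<close>
        is green, so the same new sets serve all of them. As \<open>p\<close> is itself possible,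
        \<open>p ! i\<close> lies in \<open>A i\<close>, and removing it lowers the
        cardinality.\<close>
      let ?A = "\<lambda>i. if w ! i = p ! i then {p ! i} else A i - {p ! i}"
      have len: "length p = k" using p Suc.prems by auto
      show "\<forall>v \<in> {v \<in> C. marking p v = marking p w}. \<forall>i < k. v ! i \<in> ?A i"
      proof (intro ballI allI impI)
        fix v i assume v: "v \<in> {v \<in> C. marking p v = marking p w}" and i: "i < k"
        then have "v ! i = p ! i \<longleftrightarrow> w ! i = p ! i"
          using len by (simp add: marking_eq_iff)
        then show "v ! i \<in> ?A i" using v i Suc.prems by auto
      qed
      show "\<forall>i < k. finite (?A i) \<and> card (?A i) \<le> Suc l"
      proof (intro allI impI)
        fix i assume i: "i < k"
        then have "p ! i \<in> A i" "finite (A i)" "card (A i) \<le> Suc (Suc l)" using p Suc.prems by auto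
        then show "finite (?A i) \<and> card (?A i) \<le> Suc l" by (auto simp: card_Diff_singleton)
      qed
    qed (use Suc.prems in auto)
    then show ?thesis using p Suc.prems(1) by auto
  qed (use assms(1) in auto)
qed

section \<open>The game as a bounded recursive term\<close>

text \<open>Formulas are terms, with value 0 for false; \<open>symb\<close> equals 1 exactly at position 0.\<close>

definition Zero :: tm where "Zero = Sub One One"
definition Neg :: "tm \<Rightarrow> tm" where "Neg t = IfSym t 1 One Zero"
definition Conj :: "tm \<Rightarrow> tm \<Rightarrow> tm" where "Conj t u = IfSym t 1 Zero u"
definition Imp :: "tm \<Rightarrow> tm \<Rightarrow> tm" where "Imp t u = IfSym t 1 One u"
definition Iff :: "tm \<Rightarrow> tm \<Rightarrow> tm" where "Iff t u = IfSym t 1 (Neg u) u"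
definition Less :: "tm \<Rightarrow> tm \<Rightarrow> tm" where "Less t u = Sub u t"
text \<open>A single round of iteration, whose accumulator takes the name of the counter and thus
  hides it.\<close>

definition Let_in :: "nat \<Rightarrow> tm \<Rightarrow> tm \<Rightarrow> tm" where "Let_in v t u = Iter v v One t u"

text \<open>\<open>Mu v t\<close> is \<open>n + 1\<close> if no \<open>v \<le> n\<close> satisfies \<open>t\<close>.\<close>

definition Mu :: "nat \<Rightarrow> tm \<Rightarrow> tm" where
  "Mu v t = Iter v v Top Zero (IfSym t 1 (Add (Var v) One) (Var v))"
text \<open>A failed search yields \<open>n + 1\<close>, the only value of \<open>Mu\<close> at
  which the blank is read.\<close>

definition Exists :: "nat \<Rightarrow> tm \<Rightarrow> tm" where "Exists v t = IfSym (Mu v t) 0 Zero One"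
definition Forall :: "nat \<Rightarrow> tm \<Rightarrow> tm" where "Forall v t = Neg (Exists v (Neg t))"

primrec Sym_in :: "tm \<Rightarrow> nat list \<Rightarrow> tm" where
  "Sym_in t [] = Zero"
| "Sym_in t (a # as) = IfSym t a One (Sym_in t as)"

text \<open>\<open>IfSym\<close> compares with constants only, so equality of two symbols is a case
  distinction over the alphabet; its size is fixed because \<sigma> is.\<close>

primrec Sym_eq :: "nat \<Rightarrow> tm \<Rightarrow> tm \<Rightarrow> tm" where
  "Sym_eq 0 t u = Zero"
| "Sym_eq (Suc a) t u = IfSym t a (Sym_in u [a]) (Sym_eq a t u)"

primrec Conjs :: "tm list \<Rightarrow> tm" where
  "Conjs [] = One"
| "Conjs (t # ts) = Conj t (Conjs ts)"

section \<open>Semantics of the logical operators\<close>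

definition holds :: "nat list \<Rightarrow> tm \<Rightarrow> (nat \<Rightarrow> nat) \<Rightarrow> bool" where
  "holds x t s \<longleftrightarrow> sem x t s \<noteq> 0"

text \<open>Saturating addition is invisible to \<open>symb\<close>, since all positions beyond the
  input read the blank.\<close>

lemma symb_cap [simp]: "symb x (min (Suc (length x)) a) = symb x a"
  by (auto simp: symb_def min_def)

lemma symb_cap_Suc [simp]: "symb x (Suc (min (Suc (length x)) a)) = symb x (Suc a)"
  by (auto simp: symb_def min_def)

lemma symb_cap_Suc' [simp]: "symb x (Suc (min (length x) a)) = symb x (Suc a)"
  by (auto simp: symb_def min_def)

context
  fixes x :: "nat list"
  assumes x0: "0 \<notin> set x"
begin

lemma symb_1_iff [simp]: "symb x v = Suc 0 \<longleftrightarrow> v = 0"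
  using symb_eq_1_iff[OF x0] by simp

lemma sem_Zero [simp]: "sem x Zero s = 0"
  by (simp add: Zero_def)

lemma holds_simps [simp]:
  "\<not> holds x Zero s"
  "holds x One s"
  "holds x (Neg t) s \<longleftrightarrow> \<not> holds x t s"
  "holds x (Conj t u) s \<longleftrightarrow> holds x t s \<and> holds x u s"
  "holds x (Imp t u) s \<longleftrightarrow> (holds x t s \<longrightarrow> holds x u s)"
  "holds x (Iff t u) s \<longleftrightarrow> (holds x t s \<longleftrightarrow> holds x u s)"
  "holds x (Less t u) s \<longleftrightarrow> sem x t s < sem x u s"
  "holds x (IfSym t a u v) s \<longleftrightarrow> (if symb x (sem x t s) = a then holds x u s else holds x v s)"
  by (auto simp: holds_def Neg_def Conj_def Imp_def Iff_def Less_def)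

lemma holds_Sym_in [simp]: "holds x (Sym_in t as) s \<longleftrightarrow> symb x (sem x t s) \<in> set as"
  by (induction as) auto

lemma holds_Sym_eq [simp]:
  "holds x (Sym_eq m t u) s \<longleftrightarrow> symb x (sem x t s) = symb x (sem x u s) \<and> symb x (sem x t s) < m"
  by (induction m) (auto simp: less_Suc_eq simp del: Sym_in.simps)

lemma holds_Conjs [simp]: "holds x (Conjs ts) s \<longleftrightarrow> (\<forall>t \<in> set ts. holds x t s)"
  by (induction ts) auto

lemma sem_Let_in [simp]: "sem x (Let_in v t u) s = sem x u (s(v := sem x t s))"
  by (simp add: Let_in_def)

lemma holds_Let_in [simp]: "holds x (Let_in v t u) s \<longleftrightarrow> holds x u (s(v := sem x t s))"
  by (simp add: holds_def)

text \<open>The accumulator is itself the candidate: it freezes once it satisfies \<open>t\<close>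
  and grows by one otherwise, so \<open>n + 1\<close> rounds bring it to the least solution or past
  the input.\<close>

lemma sem_Mu: "sem x (Mu v t) s = (LEAST j. j = Suc (length x) \<or> holds x t (s(v := j)))"
proof -
  define P where "P j \<longleftrightarrow> holds x t (s(v := j))" for j
  define y where "y m = fold (\<lambda>k y. sem x (IfSym t 1 (Add (Var v) One) (Var v)) (s(v := k, v := y))) [0..<m] 0" for m
  have y: "y 0 = 0" "y (Suc m) = (if P (y m) then y m else min (Suc (length x)) (Suc (y m)))" for m
    by (simp_all add: y_def P_def holds_def)
  have "y m \<le> m \<and> (\<forall>j < y m. \<not> P j) \<and> (y m < m \<longrightarrow> P (y m))" if "m \<le> Suc (length x)" for m
    using that
  proof (induction m)
    case (Suc m)
    then have IH: "y m \<le> m" "\<forall>j < y m. \<not> P j" "y m < m \<longrightarrow> P (y m)" by auto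
    then have "y (Suc m) = (if P (y m) then y m else Suc (y m))"
      using Suc.prems by (simp add: y)
    then show ?case using IH by (auto simp: less_Suc_eq)
  qed (simp add: y)
  from this[OF order_refl] have "(LEAST j. j = Suc (length x) \<or> P j) = y (Suc (length x))"
    by (intro Least_equality) (auto simp: not_less[symmetric])
  then show ?thesis
    by (simp only: Mu_def sem.simps(3,7) sem_Zero y_def P_def)
qed

lemma holds_Exists [simp]: "holds x (Exists v t) s \<longleftrightarrow> (\<exists>j \<le> length x. holds x t (s(v := j)))"
proof -
  let ?L = "LEAST j. j = Suc (length x) \<or> holds x t (s(v := j))"
  have L: "?L = Suc (length x) \<or> holds x t (s(v := ?L))"
    by (rule LeastI) (rule disjI1[OF refl])
  have L': "?L \<le> Suc (length x)" by (rule Least_le) simp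
  have "holds x (Exists v t) s \<longleftrightarrow> ?L \<le> length x"
    by (simp add: Exists_def sem_Mu symb_eq_0_iff not_less)
  also have "\<dots> \<longleftrightarrow> (\<exists>j \<le> length x. holds x t (s(v := j)))"
  proof
    assume "?L \<le> length x"
    then show "\<exists>j \<le> length x. holds x t (s(v := j))" using L by (intro exI[of _ ?L]) auto
  next
    assume "\<exists>j \<le> length x. holds x t (s(v := j))"
    then obtain j where "j \<le> length x" "holds x t (s(v := j))" by blast
    then show "?L \<le> length x" by (intro order_trans[OF Least_le, of _ j]) auto
  qed
  finally show ?thesis .
qed

lemma holds_Forall [simp]: "holds x (Forall v t) s \<longleftrightarrow> (\<forall>j \<le> length x. holds x t (s(v := j)))"
  by (simp add: Forall_def)

end

section \<open>Words and markings read off the input\<close>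

definition Letter_at :: "nat \<Rightarrow> nat \<Rightarrow> tm" where
  "Letter_at p i = Add (Add (Var p) (Var i)) One"

lemma symb_Letter_at [simp]: "symb x (sem x (Letter_at p i) s) = symb x (Suc (s p + s i))"
  by (simp add: Letter_at_def)

text \<open>
  Words are represented by the positions of the symbols 1 preceding them. Since \<open>symb\<close> adds 1 to
  the input symbols, it is 2 at these positions, 3 and 4 at binary digits, and \<open>5 + a\<close> at the letter \<open>a\<close>.
\<close>

definition word_at :: "nat list \<Rightarrow> nat \<Rightarrow> nat list" where
  "word_at x p = map (\<lambda>a. a - 4) (takeWhile ((\<le>) 4) (drop p x))"

definition starts :: "nat list \<Rightarrow> nat set" where
  "starts x = {p. p \<le> length x \<and> symb x p = 2}"

text \<open>
  Variable 1 holds the common length of the words, 2 is a position within words, 3 to 6 are local,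
  7 holds the position of the first word, and the variables from 10 on range over positions of words.
\<close>

definition Green_at :: "nat \<Rightarrow> nat \<Rightarrow> nat \<Rightarrow> tm" where
  "Green_at \<sigma> p w = Sym_eq (5 + \<sigma>) (Letter_at w 2) (Letter_at p 2)"

definition Filling :: "nat \<Rightarrow> nat \<Rightarrow> nat \<Rightarrow> tm" where
  "Filling \<sigma> p w = Conj (Sym_eq (5 + \<sigma>) (Letter_at w 4) (Letter_at p 2))
     (Neg (Sym_eq (5 + \<sigma>) (Letter_at p 4) (Letter_at p 2)))"

definition Fillable :: "nat \<Rightarrow> nat \<Rightarrow> nat \<Rightarrow> tm" where
  "Fillable \<sigma> p w = Imp (Less (Var 5) (Var 1)) (Conj (Neg (Less (Var 5) (Var 3)))
     (Conj (Sym_eq (5 + \<sigma>) (Letter_at p 5) (Letter_at p 2))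
       (Neg (Conj (Less (Var 5) (Var 4)) (Sym_eq (5 + \<sigma>) (Letter_at w 5) (Letter_at p 2))))))"

text \<open>Variable 3 is the pointer, 4 the index of the recursion and 5 the candidate of the
  minimisation. The letter is named by variable 2, a position at which it occurs in the
  guess.\<close>

definition Fill :: "nat \<Rightarrow> nat \<Rightarrow> nat \<Rightarrow> tm" where
  "Fill \<sigma> p w = Iter 3 4 (Var 1) Zero
     (IfSym (Filling \<sigma> p w) 1 (Var 3) (Add (Mu 5 (Fillable \<sigma> p w)) One))"

definition Marking_eq :: "nat \<Rightarrow> nat \<Rightarrow> nat \<Rightarrow> nat \<Rightarrow> tm" where
  "Marking_eq \<sigma> p v w = Forall 2 (Imp (Less (Var 2) (Var 1))
     (Conj (Iff (Green_at \<sigma> p v) (Green_at \<sigma> p w))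
       (Imp (Neg (Green_at \<sigma> p v))
         (Iff (Less (Var 2) (Fill \<sigma> p v)) (Less (Var 2) (Fill \<sigma> p w))))))"

definition Word_eq :: "nat \<Rightarrow> nat \<Rightarrow> nat \<Rightarrow> tm" where
  "Word_eq \<sigma> p w = Forall 2 (Imp (Less (Var 2) (Var 1)) (Green_at \<sigma> p w))"

text \<open>The list \<open>h\<close> holds the variables of the earlier rounds: a guess and a word
  standing for the marking received. A candidate must cause the same marking as that word in each
  round, so the set \<open>C\<close> of \<open>wins\<close> is restated at every level. Numbering by
  \<open>length h\<close> makes the two variables of a round fresh.\<close>

primrec Wins :: "nat \<Rightarrow> nat \<Rightarrow> (nat \<times> nat) list \<Rightarrow> tm" where
  "Wins \<sigma> 0 h = Zero"
| "Wins \<sigma> (Suc l) h = (let p = 10 + 2 * length h; w = 11 + 2 * length h in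
     Exists p (Conj (Sym_in (Var p) [2])
       (Forall w (Imp (Conj (Sym_in (Var w) [2])
           (Conj (Conjs (map (\<lambda>(q, v). Marking_eq \<sigma> q w v) h)) (Neg (Word_eq \<sigma> p w))))
         (Wins \<sigma> l ((p, w) # h))))))"

context
  fixes x :: "nat list" and \<sigma> k :: nat
  assumes x: "set x \<subseteq> wordle_alphabet \<sigma>"
    and k: "\<And>p. p \<in> starts x \<Longrightarrow> length (word_at x p) = k"
begin

lemma zero_notin: "0 \<notin> set x"
  using x by (auto simp: wordle_alphabet_def)

lemma symb_less: "symb x v < 5 + \<sigma>"
proof -
  have "x ! i < 4 + \<sigma>" if "i < length x" for i
    using x nth_mem[OF that] by (auto simp: wordle_alphabet_def)
  from this[of "v - 1"] show ?thesis by (auto simp: symb_def)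
qed

lemma starts_bound: assumes "p \<in> starts x" shows "p + k \<le> length x" and "0 < p"
proof -
  have "k \<le> length (drop p x)"
    using k[OF assms] length_takeWhile_le[of "(\<le>) 4" "drop p x"] by (simp add: word_at_def)
  moreover have "p \<le> length x" using assms by (simp add: starts_def)
  ultimately show "p + k \<le> length x" by simp
  show "0 < p" using assms by (cases p) (auto simp: starts_def symb_def)
qed

lemma symb_word_at:
  assumes "p \<in> starts x" "i < k"
  shows "symb x (Suc (p + i)) = 5 + word_at x p ! i"
proof -
  have i: "i < length (takeWhile ((\<le>) 4) (drop p x))" using k[OF assms(1)] assms(2) by (simp add: word_at_def)
  have "4 \<le> takeWhile ((\<le>) 4) (drop p x) ! i" using set_takeWhileD[OF nth_mem[OF i]] by simp
  moreover have "takeWhile ((\<le>) 4) (drop p x) ! i = x ! (p + i)"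
    using i starts_bound(1)[OF assms(1)] assms(2) by (simp add: takeWhile_nth)
  ultimately show ?thesis
    using i starts_bound(1)[OF assms(1)] assms(2) by (simp add: symb_def word_at_def)
qed

lemma holds_Green_at:
  assumes "s p \<in> starts x" "s w \<in> starts x" "s 2 < k"
  shows "holds x (Green_at \<sigma> p w) s \<longleftrightarrow> word_at x (s w) ! s 2 = word_at x (s p) ! s 2"
  using assms symb_less[of "Suc (s w + s 2)"] by (auto simp: Green_at_def zero_notin symb_word_at)

lemma sem_Fill:
  assumes s: "s p \<in> starts x" "s w \<in> starts x" "s 2 < k" "s 1 = k" and pw: "10 \<le> p" "10 \<le> w"
  shows "sem x (Fill \<sigma> p w) s = fill (word_at x (s p)) (word_at x (s w)) (word_at x (s p) ! s 2) k"
proof -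
  define P W where "P = word_at x (s p)" and "W = word_at x (s w)"
  define a where "a = P ! s 2"
  have P: "length P = k" using k[OF s(1)] by (simp add: P_def)
  have symb: "symb x (Suc (s p + i)) = 5 + P ! i" "symb x (Suc (s w + i)) = 5 + W ! i" if "i < k" for i
    using symb_word_at s that by (simp_all add: P_def W_def)
  have kn: "k < length x" using starts_bound[OF s(1)] by simp
  have ne: "p \<noteq> 3" "p \<noteq> 4" "p \<noteq> 5" "w \<noteq> 3" "w \<noteq> 4" "w \<noteq> 5" using pw by auto
  have a: "symb x (Suc (s p + s 2)) = 5 + a" using symb s(3) by (simp add: a_def)
  define body where "body = (\<lambda>j y. sem x
     (IfSym (Filling \<sigma> p w) 1 (Var 3) (Add (Mu 5 (Fillable \<sigma> p w)) One)) (s(4 := j, 3 := y)))"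
  have body: "body i f = (if W ! i = a \<and> P ! i \<noteq> a
      then Suc (LEAST j. length P \<le> j \<or> f \<le> j \<and> P ! j = a \<and> \<not> (j < i \<and> W ! j = a)) else f)"
    if i: "i < k" for i f
  proof -
    let ?s = "s(4 := i, 3 := f)"
    have c: "holds x (Filling \<sigma> p w) ?s \<longleftrightarrow> W ! i = a \<and> P ! i \<noteq> a"
      using symb[OF i] a ne symb_less[of "Suc (s w + i)"] symb_less[of "Suc (s p + i)"]
      by (auto simp: Filling_def zero_notin)
    have d: "holds x (Fillable \<sigma> p w) (?s(5 := j)) \<longleftrightarrow>
        length P \<le> j \<or> f \<le> j \<and> P ! j = a \<and> \<not> (j < i \<and> W ! j = a)" for j
    proof (cases "j < k")
      case True
      then show ?thesis
        using symb[OF True] a ne s(4) P symb_less[of "Suc (s w + j)"] symb_less[of "Suc (s p + j)"]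
        by (auto simp: Fillable_def zero_notin)
    qed (use s(4) P zero_notin in \<open>simp add: Fillable_def\<close>)
    let ?Q = "\<lambda>j. length P \<le> j \<or> f \<le> j \<and> P ! j = a \<and> \<not> (j < i \<and> W ! j = a)"
    have le: "Least ?Q \<le> k" using P by (intro Least_le) simp
    have "sem x (Mu 5 (Fillable \<sigma> p w)) ?s = (LEAST j. j = Suc (length x) \<or> ?Q j)"
      unfolding sem_Mu[OF zero_notin] d ..
    \<comment> \<open>The default \<open>n + 1\<close> of \<open>Mu\<close> is not reached: already
      \<open>k\<close>, which is below the input length, satisfies \<open>?Q\<close>.\<close>
    also have "\<dots> = Least ?Q"
    proof (rule Least_equality)
      show "Least ?Q = Suc (length x) \<or> ?Q (Least ?Q)"
        by (rule disjI2, rule LeastI[of ?Q k]) (simp add: P)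
      show "Least ?Q \<le> j" if "j = Suc (length x) \<or> ?Q j" for j
        using that le kn by (auto intro: Least_le)
    qed
    finally have Mu: "sem x (Mu 5 (Fillable \<sigma> p w)) ?s = Least ?Q" .
    have "body i f = (if holds x (Filling \<sigma> p w) ?s then min (Suc (length x)) (sem x (Mu 5 (Fillable \<sigma> p w)) ?s + 1) else f)"
      by (simp add: body_def holds_def zero_notin)
    then show ?thesis using le kn unfolding c Mu by simp
  qed
  have "fold body [0..<i] 0 = fill P W a i" if "i \<le> k" for i
    using that by (induction i) (simp_all add: body)
  then show ?thesis
    using s(4) unfolding P_def[symmetric] W_def[symmetric] a_def[symmetric]
    by (simp add: Fill_def zero_notin body_def)
qed

lemma holds_Marking_eq:
  assumes "s p \<in> starts x" "s v \<in> starts x" "s w \<in> starts x" "s 1 = k" "10 \<le> p" "10 \<le> v" "10 \<le> w"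
  shows "holds x (Marking_eq \<sigma> p v w) s \<longleftrightarrow>
    marking (word_at x (s p)) (word_at x (s v)) = marking (word_at x (s p)) (word_at x (s w))"
proof -
  have ne: "p \<noteq> 2" "v \<noteq> 2" "w \<noteq> 2" using assms(5-) by auto
  have kn: "k < length x" using starts_bound[OF assms(1)] by simp
  have len: "length (word_at x (s p)) = k" using k assms by simp
  show ?thesis
    unfolding marking_eq_iff len using assms ne kn
    by (auto simp: Marking_eq_def zero_notin holds_Green_at sem_Fill)
qed

lemma holds_Word_eq:
  assumes "s p \<in> starts x" "s w \<in> starts x" "s 1 = k" "10 \<le> p" "10 \<le> w"
  shows "holds x (Word_eq \<sigma> p w) s \<longleftrightarrow> word_at x (s w) = word_at x (s p)"
proof -
  have ne: "p \<noteq> 2" "w \<noteq> 2" using assms(4-) by auto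
  have kn: "k < length x" using starts_bound[OF assms(1)] by simp
  have len: "length (word_at x (s p)) = k" "length (word_at x (s w)) = k" using k assms by simp_all
  show ?thesis
    unfolding list_eq_iff_nth_eq len using assms ne kn
    by (auto simp: Word_eq_def zero_notin holds_Green_at)
qed

lemma holds_Wins:
  assumes "s 1 = k" "\<forall>(p, w) \<in> set h. p \<in> {10..<10 + 2 * length h} \<and> w \<in> {10..<10 + 2 * length h} \<and>
    s p \<in> starts x \<and> s w \<in> starts x"
  shows "holds x (Wins \<sigma> l h) s \<longleftrightarrow> wins (word_at x ` starts x) l
    {v \<in> word_at x ` starts x. \<forall>(p, w) \<in> set h. marking (word_at x (s p)) v = marking (word_at x (s p)) (word_at x (s w))}"
  using assms
proof (induction l arbitrary: h s)
  case 0
  then show ?case by (simp add: zero_notin)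
next
  case (Suc l)
  let ?D = "word_at x ` starts x"
  define P W where "P = 10 + 2 * length h" and "W = 11 + 2 * length h"
  have PW: "P \<noteq> W" "P \<noteq> 1" "W \<noteq> 1" "10 \<le> P" "10 \<le> W" by (auto simp: P_def W_def)
  let ?c = "\<lambda>v. \<forall>(p, w) \<in> set h. marking (word_at x (s p)) v = marking (word_at x (s p)) (word_at x (s w))"
  have 1: "holds x (Conjs (map (\<lambda>(q, v). Marking_eq \<sigma> q W v) h)) (s(P := i, W := j)) \<longleftrightarrow> ?c (word_at x j)"
    if "j \<in> starts x" for i j
  proof -
    have "holds x (Marking_eq \<sigma> q W v) (s(P := i, W := j)) \<longleftrightarrow>
        marking (word_at x (s q)) (word_at x j) = marking (word_at x (s q)) (word_at x (s v))"
      if qv: "(q, v) \<in> set h" for q v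
    proof -
      have "q \<noteq> P" "q \<noteq> W" "v \<noteq> P" "v \<noteq> W" "10 \<le> q" "10 \<le> v" "s q \<in> starts x" "s v \<in> starts x"
        using Suc.prems(2) qv by (auto simp: P_def W_def)
      then show ?thesis
        using \<open>j \<in> starts x\<close> Suc.prems(1) PW by (subst holds_Marking_eq) auto
    qed
    then show ?thesis by (auto simp: zero_notin)
  qed
  have 2: "holds x (Wins \<sigma> l ((P, W) # h)) (s(P := i, W := j)) \<longleftrightarrow>
      wins ?D l {v \<in> {v \<in> ?D. ?c v}. marking (word_at x i) v = marking (word_at x i) (word_at x j)}"
    if ij: "i \<in> starts x" "j \<in> starts x" for i j
  proof -
    let ?s = "s(P := i, W := j)"
    have h: "(q, v) \<in> set h \<Longrightarrow> q \<in> {10..<P} \<and> v \<in> {10..<P} \<and> s q \<in> starts x \<and> s v \<in> starts x" for q v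
      using Suc.prems(2) by (auto simp: P_def)
    have same: "(q, v) \<in> set h \<Longrightarrow> ?s q = s q \<and> ?s v = s v" for q v
      using h[of q v] PW by (auto simp: P_def W_def)
    have "holds x (Wins \<sigma> l ((P, W) # h)) ?s \<longleftrightarrow> wins ?D l {v \<in> ?D. \<forall>(p, w) \<in> set ((P, W) # h).
        marking (word_at x (?s p)) v = marking (word_at x (?s p)) (word_at x (?s w))}"
    proof (rule Suc.IH)
      show "?s 1 = k" using Suc.prems(1) PW by simp
      show "\<forall>(p, w) \<in> set ((P, W) # h). p \<in> {10..<10 + 2 * length ((P, W) # h)} \<and>
          w \<in> {10..<10 + 2 * length ((P, W) # h)} \<and> ?s p \<in> starts x \<and> ?s w \<in> starts x"
        using h same ij PW by (fastforce simp: P_def W_def)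
    qed
    \<comment> \<open>Adding a pair to the history intersects the candidate set with one more
      marking class.\<close>
    also have "{v \<in> ?D. \<forall>(p, w) \<in> set ((P, W) # h).
        marking (word_at x (?s p)) v = marking (word_at x (?s p)) (word_at x (?s w))} =
        {v \<in> {v \<in> ?D. ?c v}. marking (word_at x i) v = marking (word_at x i) (word_at x j)}"
      using PW(1) same by (fastforce simp del: fun_upd_apply simp: fun_upd_same fun_upd_other)
    finally show ?thesis .
  qed
  have 3: "holds x (Word_eq \<sigma> P W) (s(P := i, W := j)) \<longleftrightarrow> word_at x j = word_at x i"
    if "i \<in> starts x" "j \<in> starts x" for i j
    using that Suc.prems(1) PW by (subst holds_Word_eq) auto
  have "holds x (Wins \<sigma> (Suc l) h) s \<longleftrightarrow> (\<exists>i \<in> starts x. \<forall>j \<in> starts x. ?c (word_at x j) \<longrightarrow>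
      word_at x j \<noteq> word_at x i \<longrightarrow> holds x (Wins \<sigma> l ((P, W) # h)) (s(P := i, W := j)))"
    using 1 3 PW(1) unfolding Wins.simps Let_def P_def[symmetric] W_def[symmetric]
    by (simp add: zero_notin starts_def del: Wins.simps) blast
  also have "\<dots> \<longleftrightarrow> (\<exists>i \<in> starts x. \<forall>j \<in> starts x. ?c (word_at x j) \<longrightarrow> word_at x j \<noteq> word_at x i \<longrightarrow>
      wins ?D l {v \<in> {v \<in> ?D. ?c v}. marking (word_at x i) v = marking (word_at x i) (word_at x j)})"
    by (intro bex_cong ball_cong imp_cong refl 2)
  also have "\<dots> \<longleftrightarrow> wins ?D (Suc l) {v \<in> ?D. ?c v}"
  proof -
    \<comment> \<open>The formula quantifies over positions and \<open>wins\<close> over words. The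
      condition depends on the words alone, so repetitions in the list are harmless.\<close>
    have "(\<exists>i \<in> A. \<forall>j \<in> A. c (f j) \<longrightarrow> f j \<noteq> f i \<longrightarrow> X (f i) (f j)) \<longleftrightarrow>
        (\<exists>p \<in> f ` A. \<forall>w \<in> {v \<in> f ` A. c v}. w \<noteq> p \<longrightarrow> X p w)"
      for A :: "nat set" and f :: "nat \<Rightarrow> nat list" and c X by blast
    then show ?thesis unfolding wins.simps .
  qed
  finally show ?case .
qed

end

section \<open>Parsing instances\<close>

lemma binary_0 [simp]: "binary 0 = []"
  by (simp add: binary.simps)

lemma binary_pos: "0 < n \<Longrightarrow> binary n = binary (n div 2) @ [n mod 2]"
  by (subst binary.simps) simp

lemma set_binary: "set (binary n) \<subseteq> {0, 1}"
proof (induction n rule: less_induct)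
  case (less n)
  then show ?case
    by (cases "n = 0") (auto simp: binary_pos)
qed

lemma hd_binary: "0 < n \<Longrightarrow> binary n \<noteq> [] \<and> hd (binary n) = 1"
proof (induction n rule: less_induct)
  case (less n)
  show ?case
  proof (cases "n = 1")
    case False
    then have "0 < n div 2" "n div 2 < n" using less.prems by auto
    from less.IH[OF this(2,1)] show ?thesis
      unfolding binary_pos[OF less.prems] by simp
  qed (simp add: binary_pos)
qed

lemma inj_binary: "inj binary"
proof (rule inj_on_inverseI)
  show "foldl (\<lambda>v d. 2 * v + d) 0 (binary n) = n" for n
  proof (induction n rule: less_induct)
    case (less n)
    then show ?case by (cases "n = 0") (auto simp: binary_pos)
  qed
qed

lemma binary_surj:
  assumes "set ds \<subseteq> {0, 1}" "ds \<noteq> []" "hd ds = 1"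
  shows "\<exists>l \<ge> 1. binary l = ds"
  using assms
proof (induction ds rule: rev_induct)
  case (snoc d ds)
  show ?case
  proof (cases "ds = []")
    case True
    then show ?thesis using snoc by (intro exI[of _ 1]) (simp add: binary_pos)
  next
    case False
    then obtain l where "1 \<le> l" "binary l = ds" using snoc by auto
    moreover have "d < 2" using snoc.prems by auto
    ultimately show ?thesis by (intro exI[of _ "2 * l + d"]) (simp add: binary_pos)
  qed
qed simp

text \<open>A structural recursion for the words that \<open>starts\<close> and
  \<open>word_at\<close> locate by position, with letters still shifted by 4; it suits induction
  over the input.\<close>

primrec words_in :: "nat list \<Rightarrow> nat list list" where
  "words_in [] = []"
| "words_in (a # x) = (if a = 1 then [takeWhile ((\<le>) 4) x] else []) @ words_in x"

lemma starts_Nil [simp]: "starts [] = {}"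
  by (auto simp: starts_def symb_def)

lemma starts_Cons: "starts (a # x) = (if a = 1 then {1} else {}) \<union> Suc ` starts x"
proof -
  have symb: "symb (a # x) (Suc v) = (if v = 0 then Suc a else symb x v)" for v
    by (cases v) (auto simp: symb_def)
  have "p \<in> starts (a # x) \<longleftrightarrow> p \<in> (if a = 1 then {1} else {}) \<union> Suc ` starts x" for p
  proof (cases p)
    case (Suc v)
    then show ?thesis by (cases v) (auto simp: starts_def symb symb_def)
  qed (auto simp: starts_def symb_def)
  then show ?thesis by blast
qed

lemma set_words_in: "set (words_in x) = (\<lambda>p. takeWhile ((\<le>) 4) (drop p x)) ` starts x"
  by (induction x) (simp_all add: starts_Cons image_Un image_image)

lemma word_at_starts: "word_at x ` starts x = map (\<lambda>a. a - 4) ` set (words_in x)"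
  by (simp add: set_words_in word_at_def image_image)

lemma words_in_append: "1 \<notin> set u \<Longrightarrow> words_in (u @ y) = words_in y"
  by (induction u) auto

lemma words_in_concat:
  "words_in (concat (map (\<lambda>w. 1 # map (\<lambda>a. 4 + a) w) ws)) = map (map (\<lambda>a. 4 + a)) ws"
proof (induction ws)
  case (Cons w ws)
  let ?y = "concat (map (\<lambda>w. 1 # map (\<lambda>a. 4 + a) w) ws)"
  have "takeWhile ((\<le>) 4) ?y = []" by (cases ws) auto
  then have "takeWhile ((\<le>) 4) (map (\<lambda>a. 4 + a) w @ ?y) = map (\<lambda>a. 4 + a) w"
    by (subst takeWhile_append2) auto
  moreover have "1 \<notin> set (map (\<lambda>a. 4 + a) w)" by auto
  ultimately show ?case using Cons.IH by (simp add: words_in_append)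
qed simp

text \<open>Letters before the first separator belong to no entry of \<open>words_in\<close>; the
  \<open>takeWhile\<close> prefix accounts for them in the induction.\<close>

lemma concat_words_in:
  "\<forall>a \<in> set y. a = 1 \<or> 4 \<le> a \<Longrightarrow> takeWhile ((\<le>) 4) y @ concat (map ((#) 1) (words_in y)) = y"
  by (induction y) auto

lemma in_words_in: "w \<in> set (words_in x) \<Longrightarrow> set w \<subseteq> set x \<inter> {4..}"
  unfolding set_words_in by (auto dest: set_takeWhileD in_set_dropD)

definition digit :: "nat \<Rightarrow> bool" where
  "digit a \<longleftrightarrow> a = 2 \<or> a = 3"

text \<open>The leading symbol 3 is the digit 1, which rules out leading zeros and
  \<open>l = 0\<close>. The rest must begin with a separator, so there is at least one word and no
  letter stands outside a word.\<close>

definition well_formed :: "nat list \<Rightarrow> bool" where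
  "well_formed x \<longleftrightarrow> x \<noteq> [] \<and> hd x = 3 \<and> dropWhile digit x \<noteq> [] \<and> hd (dropWhile digit x) = 1 \<and>
     (\<forall>a \<in> set (dropWhile digit x). \<not> digit a) \<and> (\<exists>k. \<forall>w \<in> set (words_in x). length w = k)"

lemma well_formed_encode_instance:
  assumes ws: "set ws \<subseteq> words_of_length \<sigma> k" "ws \<noteq> []" and l: "1 \<le> l"
  shows "well_formed (encode_instance ws l)"
    and "takeWhile digit (encode_instance ws l) = map (\<lambda>b. 2 + b) (binary l)"
    and "word_at (encode_instance ws l) ` starts (encode_instance ws l) = set ws"
proof -
  let ?u = "map (\<lambda>b. 2 + b) (binary l)" and ?y = "concat (map (\<lambda>w. 1 # map (\<lambda>a. 4 + a) w) ws)"
  have x: "encode_instance ws l = ?u @ ?y" by (simp add: encode_instance_def)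
  have u: "\<forall>a \<in> set ?u. digit a" using set_binary[of l] by (auto simp: digit_def)
  have y: "?y \<noteq> [] \<and> hd ?y = 1" using ws(2) by (cases ws) auto
  then have ty: "takeWhile digit ?y = []" "dropWhile digit ?y = ?y"
    by (cases ?y; simp add: digit_def)+
  have t: "takeWhile digit (?u @ ?y) = ?u" "dropWhile digit (?u @ ?y) = ?y"
    using u ty by (subst takeWhile_append2 dropWhile_append2; force)+
  have "1 \<notin> set ?u" using u by (auto simp: digit_def)
  then have w: "words_in (?u @ ?y) = map (map (\<lambda>a. 4 + a)) ws"
    unfolding words_in_append[OF \<open>1 \<notin> set ?u\<close>] by (intro words_in_concat)
  show "takeWhile digit (encode_instance ws l) = ?u" unfolding x by (rule t)
  have "map (\<lambda>a. a - 4) (map (\<lambda>a. 4 + a) w) = w" for w :: "nat list"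
    by (induction w) auto
  then show "word_at (encode_instance ws l) ` starts (encode_instance ws l) = set ws"
    unfolding x word_at_starts w by (simp add: image_image)
  have "\<forall>a \<in> set ?y. \<not> digit a" by (auto simp: digit_def)
  moreover have "\<forall>w \<in> set (words_in (?u @ ?y)). length w = k"
    using ws(1) unfolding w by (auto simp: words_of_length_def)
  moreover have "?u @ ?y \<noteq> [] \<and> hd (?u @ ?y) = 3"
    using hd_binary[of l] l by (cases "binary l") auto
  ultimately show "well_formed (encode_instance ws l)"
    using y unfolding well_formed_def x t by blast
qed

lemma well_formed_decode:
  assumes x: "set x \<subseteq> wordle_alphabet \<sigma>" and wf: "well_formed x"
  obtains ws l k where "x = encode_instance ws l" "set ws \<subseteq> words_of_length \<sigma> k" "ws \<noteq> []" "1 \<le> l"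
proof -
  let ?u = "takeWhile digit x" and ?y = "dropWhile digit x"
  from wf have y: "?y \<noteq> []" "hd ?y = 1" "\<forall>a \<in> set ?y. \<not> digit a" by (auto simp: well_formed_def)
  obtain k where k: "\<And>w. w \<in> set (words_in x) \<Longrightarrow> length w = k" using wf by (auto simp: well_formed_def)
  have u: "\<forall>a \<in> set ?u. digit a" by (auto dest: set_takeWhileD)
  then have "1 \<notin> set ?u" by (auto simp: digit_def)
  then have wy: "words_in x = words_in ?y"
    using words_in_append[of ?u ?y] unfolding takeWhile_dropWhile_id by blast
  have "\<forall>a \<in> set ?y. a = 1 \<or> 4 \<le> a"
  proof
    fix a assume "a \<in> set ?y"
    then have "\<not> digit a" "a \<in> set x" using y(3) by (auto dest: set_dropWhileD)
    then have "\<not> digit a" "1 \<le> a" using x by (auto simp: wordle_alphabet_def)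
    then show "a = 1 \<or> 4 \<le> a" by (auto simp: digit_def)
  qed
  moreover have "takeWhile ((\<le>) 4) ?y = []" using y by (cases ?y) auto
  ultimately have cy: "concat (map ((#) 1) (words_in x)) = ?y"
    using concat_words_in[of ?y] unfolding wy by (metis append_Nil)
  define ws where "ws = map (map (\<lambda>a. a - 4)) (words_in x)"
  have w: "set w \<subseteq> {4..<4 + \<sigma>}" if "w \<in> set (words_in x)" for w
  proof
    fix a assume "a \<in> set w"
    then have "4 \<le> a" "a \<in> wordle_alphabet \<sigma>" using in_words_in[OF that] x by blast+
    then show "a \<in> {4..<4 + \<sigma>}" by (simp add: wordle_alphabet_def)
  qed
  have "map (\<lambda>a. 4 + a) (map (\<lambda>a. a - 4) w) = w" if "w \<in> set (words_in x)" for w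
    using w[OF that] by (induction w) auto
  then have "1 # map (\<lambda>a. 4 + a) (map (\<lambda>a. a - 4) w) = 1 # w" if "w \<in> set (words_in x)" for w
    using that by blast
  then have "map (\<lambda>w. 1 # map (\<lambda>a. 4 + a) w) ws = map ((#) 1) (words_in x)"
    unfolding ws_def map_map o_def by (intro map_cong refl) assumption
  then have y': "concat (map (\<lambda>w. 1 # map (\<lambda>a. 4 + a) w) ws) = ?y" using cy by simp
  define ds where "ds = map (\<lambda>a. a - 2) ?u"
  have ds: "map (\<lambda>b. 2 + b) ds = ?u"
  proof -
    have "map (\<lambda>b. 2 + b) (map (\<lambda>a. a - 2) v) = v" if "\<forall>a \<in> set v. digit a" for v
      using that by (induction v) (auto simp: digit_def)
    from this[OF u] show ?thesis unfolding ds_def .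
  qed
  have "x \<noteq> []" "hd x = 3" using wf by (simp_all add: well_formed_def)
  then have "takeWhile digit x = 3 # takeWhile digit (tl x)" by (cases x) (auto simp: digit_def)
  then have "ds \<noteq> []" "hd ds = 1" by (simp_all add: ds_def)
  moreover have "set ds \<subseteq> {0, 1}" using u by (auto simp: ds_def digit_def)
  ultimately obtain l where l: "1 \<le> l" "binary l = ds" using binary_surj[of ds] by blast
  show thesis
  proof (rule that)
    show "x = encode_instance ws l"
      unfolding encode_instance_def y' l(2) ds takeWhile_dropWhile_id ..
    show "set ws \<subseteq> words_of_length \<sigma> k"
    proof
      fix v assume "v \<in> set ws"
      then obtain v' where v': "v' \<in> set (words_in x)" "v = map (\<lambda>a. a - 4) v'" by (auto simp: ws_def)
      have "a - 4 < \<sigma>" if "a \<in> set v'" for a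
        using subsetD[OF w[OF v'(1)] that] by auto
      then show "v \<in> words_of_length \<sigma> k" using k[OF v'(1)] v'(2) by (auto simp: words_of_length_def)
    qed
    have "concat (map (\<lambda>w. 1 # map (\<lambda>a. 4 + a) w) ws) \<noteq> []" unfolding y' by (rule y(1))
    then show "ws \<noteq> []" by (cases ws) simp_all
  qed (rule l(1))
qed

text \<open>Since \<open>P\<close> fails at the symbol 0, the blank after the input stops a scan
  that runs to its end.\<close>

lemma scan_eq:
  assumes "\<not> P 0" "p \<le> length x"
  shows "(LEAST j. j = Suc (length x) \<or> \<not> P (symb x (Suc (p + j)))) = length (takeWhile (\<lambda>a. P (Suc a)) (drop p x))"
    (is "_ = length ?t")
proof (rule Least_equality)
  have le: "length ?t \<le> length x - p" using length_takeWhile_le[of _ "drop p x"] by simp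
  have "\<not> P (symb x (Suc (p + length ?t)))"
  proof (cases "length ?t < length (drop p x)")
    case True
    then have "Suc (p + length ?t) \<le> length x" by simp
    then show ?thesis using nth_length_takeWhile[OF True] by (simp add: symb_def)
  next
    case False
    then have "length x < Suc (p + length ?t)" using assms(2) by simp
    then show ?thesis using assms(1) by (simp add: symb_def)
  qed
  then show "length ?t = Suc (length x) \<or> \<not> P (symb x (Suc (p + length ?t)))" by blast
  fix j assume j: "j = Suc (length x) \<or> \<not> P (symb x (Suc (p + j)))"
  show "length ?t \<le> j"
  proof (rule ccontr)
    assume "\<not> length ?t \<le> j"
    then have jt: "j < length ?t" by simp
    then have "P (Suc (?t ! j))" using set_takeWhileD[OF nth_mem[OF jt]] by simp
    moreover have "?t ! j = x ! (p + j)" using jt le assms(2) by (simp add: takeWhile_nth)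
    moreover have "Suc (p + j) \<le> length x" using jt le by simp
    ultimately have "P (symb x (Suc (p + j)))" by (simp add: symb_def)
    then show False using j jt le by auto
  qed
qed

section \<open>The term that decides an instance\<close>

definition Is_digit :: "tm \<Rightarrow> tm" where
  "Is_digit t = Sym_in t [3, 4]"

text \<open>The symbols 0 to 4 are those that end a word: the blank, the left marker, the separator
  and the two digits.\<close>

definition Word_length :: "nat \<Rightarrow> tm" where
  "Word_length p = Mu 6 (Sym_in (Letter_at p 6) [0, 1, 2, 3, 4])"

definition Equal :: "tm \<Rightarrow> tm \<Rightarrow> tm" where
  "Equal t u = Conj (Neg (Less t u)) (Neg (Less u t))"

text \<open>The numeral is compared digit by digit with a constant, so a huge number is never
  evaluated. The final test for a non-digit excludes longer numerals.\<close>

primrec Has_digits :: "nat list \<Rightarrow> tm \<Rightarrow> tm" where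
  "Has_digits [] t = Neg (Is_digit t)"
| "Has_digits (d # ds) t = IfSym t (3 + d) (Has_digits ds (Add t One)) Zero"

text \<open>Instead of searching for a common length, the term compares every word with the first
  one, whose length \<open>Wordle\<close> puts into variable 1.\<close>

definition Well_formed :: tm where
  "Well_formed = Conjs
     [Sym_in One [4], Sym_in (Var 7) [2],
      Forall 10 (Imp (Less (Var 7) (Var 10)) (Neg (Is_digit (Var 10)))),
      Forall 10 (Imp (Sym_in (Var 10) [2]) (Equal (Word_length 10) (Var 1)))]"

text \<open>For \<open>l \<ge> \<sigma>\<close> no premise is met, and well-formedness alone
  decides. The instance \<open>j = 0\<close> would require an empty numeral, which a well-formed
  input does not have.\<close>

definition Wordle :: "nat \<Rightarrow> tm" where
  "Wordle \<sigma> = Let_in 7 (Add (Mu 6 (Neg (Is_digit (Add (Var 6) One)))) One)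
     (Let_in 1 (Word_length 7)
       (Conj Well_formed (Conjs (map (\<lambda>j. Imp (Has_digits (binary j) One) (Wins \<sigma> j [])) [0..<\<sigma>]))))"

lemma symb_digit: "symb x (Suc p) \<in> {3, 4} \<longleftrightarrow> p < length x \<and> digit (x ! p)"
  by (auto simp: symb_def digit_def)

lemma holds_Has_digits:
  assumes "0 \<notin> set x" "sem x t s = min (Suc (length x)) (Suc p)" "set ds \<subseteq> {0, 1}"
  shows "holds x (Has_digits ds t) s \<longleftrightarrow> takeWhile digit (drop p x) = map (\<lambda>b. 2 + b) ds"
  using assms(2-)
proof (induction ds arbitrary: t p)
  case Nil
  have "symb x (sem x t s) = symb x (Suc p)" unfolding Nil(1) by simp
  then have "holds x (Has_digits [] t) s \<longleftrightarrow> symb x (Suc p) \<notin> {3, 4}"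
    using assms(1) by (simp add: Is_digit_def)
  also have "\<dots> \<longleftrightarrow> takeWhile digit (drop p x) = []"
    unfolding symb_digit by (cases "p < length x") (auto simp: Cons_nth_drop_Suc[symmetric])
  finally show ?case by simp
next
  case (Cons d ds)
  have "symb x (sem x t s) = symb x (Suc p)" unfolding Cons(2) by simp
  moreover have "holds x (Has_digits ds (Add t One)) s \<longleftrightarrow> takeWhile digit (drop (Suc p) x) = map (\<lambda>b. 2 + b) ds"
    using Cons.prems by (intro Cons.IH) auto
  ultimately have "holds x (Has_digits (d # ds) t) s \<longleftrightarrow>
      symb x (Suc p) = 3 + d \<and> takeWhile digit (drop (Suc p) x) = map (\<lambda>b. 2 + b) ds"
    using assms(1) by simp
  also have "\<dots> \<longleftrightarrow> takeWhile digit (drop p x) = map (\<lambda>b. 2 + b) (d # ds)"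
    using Cons.prems(2)
    by (cases "p < length x") (auto simp: symb_def digit_def Cons_nth_drop_Suc[symmetric])
  finally show ?case .
qed

lemma sem_Word_length:
  assumes "0 \<notin> set x" "s p \<le> length x" "p \<noteq> 6"
  shows "sem x (Word_length p) s = length (takeWhile ((\<le>) 4) (drop (s p) x))"
proof -
  have "a \<in> {0, 1, 2, 3, 4} \<longleftrightarrow> \<not> 5 \<le> a" for a :: nat by auto
  then have "holds x (Sym_in (Letter_at p 6) [0, 1, 2, 3, 4]) (s(6 := j)) \<longleftrightarrow>
      \<not> 5 \<le> symb x (Suc (s p + j))" for j
    unfolding holds_Sym_in[OF assms(1)] using assms(3) by simp
  then have "sem x (Word_length p) s = (LEAST j. j = Suc (length x) \<or> \<not> 5 \<le> symb x (Suc (s p + j)))"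
    unfolding Word_length_def sem_Mu[OF assms(1)] by presburger
  also have "\<dots> = length (takeWhile (\<lambda>a. 5 \<le> Suc a) (drop (s p) x))"
    by (rule scan_eq) (use assms in auto)
  finally show ?thesis by (simp add: numeral_eq_Suc)
qed

lemma holds_Wordle:
  assumes x: "set x \<subseteq> wordle_alphabet \<sigma>"
  shows "holds x (Wordle \<sigma>) (\<lambda>_. 0) \<longleftrightarrow> well_formed x \<and>
    (\<forall>j < \<sigma>. takeWhile digit x = map (\<lambda>b. 2 + b) (binary j) \<longrightarrow>
      wins (word_at x ` starts x) j (word_at x ` starts x))"
proof -
  have x0: "0 \<notin> set x" using x by (auto simp: wordle_alphabet_def)
  define b where "b = length (takeWhile digit x)"
  have b: "b \<le> length x" by (simp add: b_def length_takeWhile_le)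
  have drop_b: "dropWhile digit x = drop b x" by (simp add: b_def dropWhile_eq_drop)
  \<comment> \<open>The digits occupy the positions 1 to \<open>b\<close>, so the first separator of
    a well-formed input is at \<open>Suc b\<close>.\<close>
  let ?s = "(\<lambda>_. 0)(7 := Suc b)"
  define k where "k = sem x (Word_length 7) ?s"
  let ?s' = "?s(1 := k)"
  have "holds x (Neg (Is_digit (Add (Var 6) One))) ((\<lambda>_. 0)(6 := j)) \<longleftrightarrow>
      \<not> (symb x (Suc (0 + j)) \<in> {3, 4})" for j
    using x0 by (simp add: Is_digit_def)
  then have "sem x (Mu 6 (Neg (Is_digit (Add (Var 6) One)))) (\<lambda>_. 0) =
      (LEAST j. j = Suc (length x) \<or> \<not> (symb x (Suc (0 + j)) \<in> {3, 4}))"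
    unfolding sem_Mu[OF x0] by presburger
  also have "\<dots> = length (takeWhile (\<lambda>a. Suc a \<in> {3, 4}) (drop 0 x))"
    by (rule scan_eq) auto
  also have "(\<lambda>a. Suc a \<in> {3, 4}) = digit" by (auto simp: digit_def fun_eq_iff)
  finally have "sem x (Mu 6 (Neg (Is_digit (Add (Var 6) One)))) (\<lambda>_. 0) = b" by (simp add: b_def)
  then have 1: "holds x (Wordle \<sigma>) (\<lambda>_. 0) \<longleftrightarrow> holds x Well_formed ?s' \<and>
      (\<forall>j < \<sigma>. holds x (Has_digits (binary j) One) ?s' \<longrightarrow> holds x (Wins \<sigma> j []) ?s')"
    using x0 b by (auto simp: Wordle_def k_def)
  have digits: "holds x (Has_digits (binary j) One) ?s' \<longleftrightarrow>
      takeWhile digit x = map (\<lambda>b. 2 + b) (binary j)" for j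
    using holds_Has_digits[OF x0 _ set_binary, of One ?s' 0] by simp
  have len: "sem x (Word_length 10) (?s'(10 := p)) = length (takeWhile ((\<le>) 4) (drop p x))"
    if "p \<le> length x" for p
    using sem_Word_length[OF x0] that by simp
  have wf: "holds x Well_formed ?s' \<longleftrightarrow> symb x 1 = 4 \<and> symb x (Suc b) = 2 \<and>
      (\<forall>v \<le> length x. Suc b < v \<longrightarrow> symb x v \<notin> {3, 4}) \<and>
      (\<forall>p \<in> starts x. length (takeWhile ((\<le>) 4) (drop p x)) = k)"
    using x0 len by (auto simp: Well_formed_def Is_digit_def Equal_def starts_def)
  have k: "length (word_at x p) = k" if "holds x Well_formed ?s'" "p \<in> starts x" for p
    using that unfolding wf word_at_def length_map by blast
  have win: "holds x (Wins \<sigma> j []) ?s' \<longleftrightarrow> wins (word_at x ` starts x) j (word_at x ` starts x)"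
    if "holds x Well_formed ?s'" for j
    by (subst holds_Wins[OF x k[OF that]]) simp_all
  have "holds x Well_formed ?s' \<longleftrightarrow> well_formed x"
  proof -
    have "symb x 1 = 4 \<longleftrightarrow> x \<noteq> [] \<and> hd x = 3"
      by (cases x) (auto simp: symb_def)
    moreover have 2: "symb x (Suc b) = 2 \<longleftrightarrow> drop b x \<noteq> [] \<and> hd (drop b x) = 1"
      using b by (auto simp: symb_def hd_drop_conv_nth)
    moreover have "(\<forall>v \<le> length x. Suc b < v \<longrightarrow> symb x v \<notin> {3, 4}) \<longleftrightarrow> (\<forall>a \<in> set (drop b x). \<not> digit a)"
      if sb: "symb x (Suc b) = 2"
    proof
      assume l: "\<forall>v \<le> length x. Suc b < v \<longrightarrow> symb x v \<notin> {3, 4}"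
      show "\<forall>a \<in> set (drop b x). \<not> digit a"
      proof
        fix a assume "a \<in> set (drop b x)"
        then obtain i where "i < length (drop b x)" "drop b x ! i = a"
          unfolding in_set_conv_nth by blast
        then have i: "b + i < length x" "a = x ! (b + i)" by auto
        show "\<not> digit a"
        proof (cases "i = 0")
          case True
          then show ?thesis using sb i by (simp add: symb_def digit_def)
        next
          case False
          then have "symb x (Suc (b + i)) \<notin> {3, 4}" using l i(1) by simp
          then show ?thesis using i by (simp only: symb_digit) simp
        qed
      qed
    next
      assume r: "\<forall>a \<in> set (drop b x). \<not> digit a"
      show "\<forall>v \<le> length x. Suc b < v \<longrightarrow> symb x v \<notin> {3, 4}"
      proof (intro allI impI)
        fix v assume v: "v \<le> length x" "Suc b < v"
        then have "drop b x ! (v - 1 - b) \<in> set (drop b x)" by (intro nth_mem) auto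
        moreover have "drop b x ! (v - 1 - b) = x ! (v - 1)" using v by (simp add: nth_drop)
        ultimately have "\<not> digit (x ! (v - 1))" using r by metis
        then show "symb x v \<notin> {3, 4}" using v symb_digit[of x "v - 1"] by simp
      qed
    qed
    moreover have "(\<forall>p \<in> starts x. length (takeWhile ((\<le>) 4) (drop p x)) = k) \<longleftrightarrow>
        (\<exists>k. \<forall>w \<in> set (words_in x). length w = k)"
      if sb: "symb x (Suc b) = 2"
    proof -
      have sb': "Suc b \<le> length x" using sb by (simp add: symb_def split: if_splits)
      then have "Suc b \<in> starts x" using sb by (simp add: starts_def)
      \<comment> \<open>The first word is among the words, so \<open>k\<close> is the only possible
        common length.\<close>
      moreover have "k = length (takeWhile ((\<le>) 4) (drop (Suc b) x))"
        unfolding k_def using sb' sem_Word_length[OF x0, of ?s 7] by simp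
      ultimately show ?thesis unfolding set_words_in by auto
    qed
    ultimately show ?thesis unfolding wf well_formed_def drop_b by blast
  qed
  then show ?thesis unfolding 1 digits using win by blast
qed

theorem theorem3:
  fixes \<sigma> :: nat
  shows "poly_time_decidable (wordle_alphabet \<sigma>) (wordle \<sigma>)"
proof (rule poly_time_decidable_tm)
  show "finite (wordle_alphabet \<sigma>)" "0 \<notin> wordle_alphabet \<sigma>" by (auto simp: wordle_alphabet_def)
  show "wordle \<sigma> \<subseteq> lists (wordle_alphabet \<sigma>)"
  proof
    fix x assume "x \<in> wordle \<sigma>"
    then obtain ws l k where x: "x = encode_instance ws l" and ws: "set ws \<subseteq> words_of_length \<sigma> k"
      by (auto simp: wordle_def)
    have "set (map (\<lambda>b. 2 + b) (binary l)) \<subseteq> wordle_alphabet \<sigma>"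
      using set_binary[of l] by (auto simp: wordle_alphabet_def)
    moreover have "set (1 # map (\<lambda>a. 4 + a) w) \<subseteq> wordle_alphabet \<sigma>" if "w \<in> set ws" for w
    proof -
      have "set w \<subseteq> {..<\<sigma>}" using ws that by (auto simp: words_of_length_def)
      then show ?thesis by (auto simp: wordle_alphabet_def)
    qed
    moreover have "set (concat (map f ws)) \<subseteq> A \<longleftrightarrow> (\<forall>w \<in> set ws. set (f w) \<subseteq> A)"
      for f :: "nat list \<Rightarrow> nat list" and A by auto
    ultimately have "set x \<subseteq> wordle_alphabet \<sigma>"
      unfolding x encode_instance_def set_append Un_subset_iff by blast
    then show "x \<in> lists (wordle_alphabet \<sigma>)" by auto
  qed
  fix x assume x: "set x \<subseteq> wordle_alphabet \<sigma>"
  have "x \<in> wordle \<sigma> \<longleftrightarrow> holds x (Wordle \<sigma>) (\<lambda>_. 0)"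
  proof
    assume "x \<in> wordle \<sigma>"
    then obtain ws l k where ws: "x = encode_instance ws l" "set ws \<subseteq> words_of_length \<sigma> k" "1 \<le> l"
      "guesser_wins (set ws) l" unfolding wordle_def mem_Collect_eq by (elim exE conjE) (rule that)
    \<comment> \<open>An empty dictionary leaves no legal guess and hence no strategy.\<close>
    have "ws \<noteq> []" using ws(4) by (auto simp: guesser_wins_def winning_strategy_def)
    note enc = well_formed_encode_instance[OF ws(2) this ws(3), folded ws(1)]
    have "\<forall>w \<in> set ws. length w = k" using ws(2) by (auto simp: words_of_length_def)
    then have win: "wins (set ws) l (set ws)"
      using ws(4) \<open>ws \<noteq> []\<close> guesser_wins_iff_wins[of "set ws" k l] by simp
    \<comment> \<open>The encoding determines the number of guesses, so only the conjunct for
      \<open>l\<close> can have a true premise.\<close>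
    have "j = l" if "takeWhile digit x = map (\<lambda>b. 2 + b) (binary j)" for j
    proof -
      have "inj (\<lambda>b :: nat. 2 + b)" by (simp add: inj_def)
      then have "inj (map (\<lambda>b :: nat. 2 + b))" by (rule inj_mapI)
      moreover have "map (\<lambda>b. 2 + b) (binary j) = map (\<lambda>b. 2 + b) (binary l)"
        using that enc(2) by (rule trans[OF sym])
      ultimately have "binary j = binary l" by (rule injD)
      then show ?thesis by (rule injD[OF inj_binary])
    qed
    then show "holds x (Wordle \<sigma>) (\<lambda>_. 0)"
      unfolding holds_Wordle[OF x] enc(3) using enc(1) win by blast
  next
    assume h: "holds x (Wordle \<sigma>) (\<lambda>_. 0)"
    then have "well_formed x" unfolding holds_Wordle[OF x] by (rule conjunct1)
    then obtain ws l k where ws: "x = encode_instance ws l" "set ws \<subseteq> words_of_length \<sigma> k" "ws \<noteq> []" "1 \<le> l"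
      by (rule well_formed_decode[OF x])
    note enc = well_formed_encode_instance[OF ws(2-4), folded ws(1)]
    have len: "\<forall>w \<in> set ws. length w = k" using ws(2) by (auto simp: words_of_length_def)
    have "wins (set ws) l (set ws)"
    proof (cases "l < \<sigma>")
      case True
      then show ?thesis using h enc(2) unfolding holds_Wordle[OF x] enc(3) by blast
    next
      \<comment> \<open>Every position allows \<sigma> letters at the start, and here \<sigma> is at
        most \<open>l\<close>.\<close>
      case False
      obtain l' where l': "l = Suc l'" using ws(4) by (cases l) auto
      show ?thesis unfolding l'
      proof (rule wins_few_letters[where A = "\<lambda>_. {..<\<sigma>}", OF _ order_refl len])
        show "\<forall>w \<in> set ws. \<forall>i < k. w ! i \<in> {..<\<sigma>}"
        proof (intro ballI allI impI)
          fix w i assume "w \<in> set ws" "i < k"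
          then have "set w \<subseteq> {..<\<sigma>}" "i < length w" using ws(2) by (auto simp: words_of_length_def)
          then show "w ! i \<in> {..<\<sigma>}" by (meson nth_mem subsetD)
        qed
      qed (use False l' ws(3) in auto)
    qed
    then have "guesser_wins (set ws) l"
      using guesser_wins_iff_wins[of "set ws" k l] ws(3) len by simp
    with ws show "x \<in> wordle \<sigma>"
      unfolding wordle_def mem_Collect_eq by (intro exI conjI)
  qed
  then show "sem x (Wordle \<sigma>) (\<lambda>_. 0) \<noteq> 0 \<longleftrightarrow> x \<in> wordle \<sigma>" by (simp add: holds_def)
qed

end
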